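(* For each integer $q\ge 1$, let $(S_n)_{n\ge0}$ be the $\varphi_\omega$-ground state process and $(W^{(0)}_n)_{n\ge0}$ the $\varphi_0$-ground state process of the simple random walk on the homogeneous tree $\mathbb T_q$, both started at $o$. The limit in law, as $q\to+\infty$, of the processes $d(o,S_n)$, $n\ge0$, and $d(o,W^{(0)}_n)$, $n\ge0$, has the same law as $$2\max_{0\le k\le n}\Sigma_k-\Sigma_n,\qquad n\ge0,$$ where $(\Sigma_n)$ is the simple symmetric random walk on $\mathbb Z$ starting at $0$.
   Context: $\mathbb T_q$ is the connected graph without cycles in which every vertex has exactly $q+1$ edges, with a fixed origin $o$ and graph distance $d$. The simple random walk $W_n$ starts at $o$ and has transition probability $P(x,y)=\frac1{q+1}$ if $x,y$ are neighbours ($0$ otherwise). Let $\varrho=\frac{2\sqrt q}{q+1}$. The function $\varphi_0(x)=\big(1+n\frac{q-1}{q+1}\big)q^{-n/2}$, $n=d(o,x)$, satisfies $P\varphi_0=\varrho\varphi_0$; $W^{(0)}$ is the Markov chain with transition probability $P^{(0)}(x,y)=\frac{1}{\varrho\varphi_0(x)}P(x,y)\varphi_0(y)$. Fix a geodesic ray $\omega=\{x_n,n\ge0\}$, i.e. an infinite sequence of distinct vertices with $d(x_n,x_{n+1})=1$, with $x_0=o$; $\pi_\omega(x)\in\omega$ is the vertex of $\omega$ closest to $x$, and $h(x)=d(x,\pi_\omega(x))-d(o,\pi_\omega(x))$. The function $\varphi_\omega(x)=q^{-h(x)/2}$ satisfies $P\varphi_\omega=\varrho\varphi_\omega$; $S$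 is the Markov chain started at $o$ with transition probability $P(x,y)\frac{\varphi_\omega(y)}{\varrho\varphi_\omega(x)}$. *)

theory Defs
  imports "HOL-Probability.Probability"
begin

section \<open>The homogeneous tree\<close>

text \<open>A simple graph is given by its vertex set \<open>V\<close> and its symmetric, irreflexive adjacency
  relation \<open>E\<close>. A cycle is a list of at least three distinct vertices, cyclically adjacent.\<close>

definition simple_graph :: "'v set \<Rightarrow> ('v \<Rightarrow> 'v \<Rightarrow> bool) \<Rightarrow> bool" where
  "simple_graph V E \<longleftrightarrow>
     (\<forall>x y. E x y \<longrightarrow> x \<in> V \<and> y \<in> V \<and> x \<noteq> y \<and> E y x)"

definition graph_connected :: "'v set \<Rightarrow> ('v \<Rightarrow> 'v \<Rightarrow> bool) \<Rightarrow> bool" where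
  "graph_connected V E \<longleftrightarrow> (\<forall>x\<in>V. \<forall>y\<in>V. E\<^sup>*\<^sup>* x y)"

definition graph_acyclic :: "('v \<Rightarrow> 'v \<Rightarrow> bool) \<Rightarrow> bool" where
  "graph_acyclic E \<longleftrightarrow>
     \<not> (\<exists>xs. 3 \<le> length xs \<and> distinct xs \<and> successively E xs \<and> E (last xs) (hd xs))"

definition homogeneous_tree :: "nat \<Rightarrow> 'v set \<Rightarrow> ('v \<Rightarrow> 'v \<Rightarrow> bool) \<Rightarrow> bool" where
  "homogeneous_tree q V E \<longleftrightarrow>
     simple_graph V E \<and> graph_connected V E \<and> graph_acyclic E \<and>
     (\<forall>x\<in>V. card {y. E x y} = q + 1)"

text \<open>The graph distance is the least number of edges of a path joining the two vertices; here
  \<open>E ^^ n\<close> is the \<open>n\<close>-fold relational composition.\<close>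

definition graph_dist :: "('v \<Rightarrow> 'v \<Rightarrow> bool) \<Rightarrow> 'v \<Rightarrow> 'v \<Rightarrow> nat" where
  "graph_dist E x y = (LEAST n. (E ^^ n) x y)"

definition geodesic_ray ::
  "'v set \<Rightarrow> ('v \<Rightarrow> 'v \<Rightarrow> bool) \<Rightarrow> 'v \<Rightarrow> (nat \<Rightarrow> 'v) \<Rightarrow> bool" where
  "geodesic_ray V E r \<omega> \<longleftrightarrow>
     (\<forall>n. \<omega> n \<in> V) \<and> inj \<omega> \<and> \<omega> 0 = r \<and> (\<forall>n. graph_dist E (\<omega> n) (\<omega> (Suc n)) = 1)"

definition ray_proj :: "('v \<Rightarrow> 'v \<Rightarrow> bool) \<Rightarrow> (nat \<Rightarrow> 'v) \<Rightarrow> 'v \<Rightarrow> 'v" where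
  "ray_proj E \<omega> x =
     (THE y. y \<in> range \<omega> \<and> (\<forall>z\<in>range \<omega>. graph_dist E x y \<le> graph_dist E x z))"

definition ray_height :: "('v \<Rightarrow> 'v \<Rightarrow> bool) \<Rightarrow> 'v \<Rightarrow> (nat \<Rightarrow> 'v) \<Rightarrow> 'v \<Rightarrow> int" where
  "ray_height E r \<omega> x =
     int (graph_dist E x (ray_proj E \<omega> x)) - int (graph_dist E r (ray_proj E \<omega> x))"


section \<open>Ground state transition probabilities\<close>

definition srw_trans :: "nat \<Rightarrow> ('v \<Rightarrow> 'v \<Rightarrow> bool) \<Rightarrow> 'v \<Rightarrow> 'v \<Rightarrow> real" where
  "srw_trans q E x y = (if E x y then 1 / (real q + 1) else 0)"

definition spec_rad :: "nat \<Rightarrow> real" where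
  "spec_rad q = 2 * sqrt (real q) / (real q + 1)"

definition ground_trans ::
  "nat \<Rightarrow> ('v \<Rightarrow> 'v \<Rightarrow> bool) \<Rightarrow> ('v \<Rightarrow> real) \<Rightarrow> 'v \<Rightarrow> 'v \<Rightarrow> real" where
  "ground_trans q E \<phi> x y = srw_trans q E x y * \<phi> y / (spec_rad q * \<phi> x)"

definition phi_zero :: "nat \<Rightarrow> ('v \<Rightarrow> 'v \<Rightarrow> bool) \<Rightarrow> 'v \<Rightarrow> 'v \<Rightarrow> real" where
  "phi_zero q E r x =
     (1 + real (graph_dist E r x) * ((real q - 1) / (real q + 1)))
       * real q powr (- real (graph_dist E r x) / 2)"

definition phi_ray ::
  "nat \<Rightarrow> ('v \<Rightarrow> 'v \<Rightarrow> bool) \<Rightarrow> 'v \<Rightarrow> (nat \<Rightarrow> 'v) \<Rightarrow> 'v \<Rightarrow> real" where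
  "phi_ray q E r \<omega> x = real q powr (- real_of_int (ray_height E r \<omega> x) / 2)"

text \<open>Transition probability of the simple symmetric random walk on the integers.\<close>

definition int_srw_trans :: "int \<Rightarrow> int \<Rightarrow> real" where
  "int_srw_trans x y = (if \<bar>x - y\<bar> = 1 then 1 / 2 else 0)"


section \<open>Markov chains and convergence in law\<close>

text \<open>\<open>X\<close> is a (time-homogeneous) Markov chain on the countable state space \<open>V\<close> (with the discrete
  sigma-algebra), started at \<open>x0\<close>, with transition probability \<open>p\<close>. The conditional law given the
  past is only prescribed for pasts \<open>(x 0, \<dots>, x n)\<close> of positive probability.\<close>

definition markov_chain ::
  "'m measure \<Rightarrow> 's set \<Rightarrow> 's \<Rightarrow> ('s \<Rightarrow> 's \<Rightarrow> real) \<Rightarrow> (nat \<Rightarrow> 'm \<Rightarrow> 's) \<Rightarrow> bool" where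
  "markov_chain M V x0 p X \<longleftrightarrow>
     prob_space M \<and>
     (\<forall>n. X n \<in> M \<rightarrow>\<^sub>M count_space V) \<and>
     (AE w in M. X 0 w = x0) \<and>
     (\<forall>n x. \<forall>y\<in>V.
        \<P>(w in M. \<forall>k\<le>n. X k w = x k) > 0 \<longrightarrow>
        \<P>(w in M. X (Suc n) w = y \<bar> \<forall>k\<le>n. X k w = x k) = p (x n) y)"

text \<open>Weak convergence of the laws of \<open>X q\<close> to the law of \<open>Y\<close> as \<open>q\<close> tends to infinity. For
  discrete-time real processes it is used with \<open>'a = nat \<Rightarrow> real\<close>, which carries the product
  topology, and the random elements are the whole trajectories.\<close>

definition converges_in_law ::
  "(nat \<Rightarrow> 'm measure) \<Rightarrow> (nat \<Rightarrow> 'm \<Rightarrow> 'a::topological_space) \<Rightarrow>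
   'n measure \<Rightarrow> ('n \<Rightarrow> 'a) \<Rightarrow> bool" where
  "converges_in_law M X N Y \<longleftrightarrow>
     (\<forall>\<^sub>F q in sequentially. X q \<in> borel_measurable (M q)) \<and>
     Y \<in> borel_measurable N \<and>
     (\<forall>f :: 'a \<Rightarrow> real. continuous_on UNIV f \<and> bounded (range f) \<longrightarrow>
        (\<lambda>q. \<integral>w. f (X q w) \<partial>M q) \<longlonglongrightarrow> (\<integral>w. f (Y w) \<partial>N))"

end

theory Submission
  imports Defs
begin

text \<open>All three processes live on the natural numbers, start at \<open>0\<close> and move by \<open>\<pm>1\<close>, so it suffices to
  find the limiting probability of every finite path \<open>d\<close>. That limit is \<open>(d n + 1) / 2 ^ n\<close> if \<open>d\<close>
  is a nearest-neighbour path from \<open>0\<close> of length \<open>n\<close>, and \<open>0\<close> otherwise: the path law of the discrete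
  three-dimensional Bessel process (\<open>bessel_path_weight\<close>).

  Spherical ground state. The distance of \<open>W\<^sup>(\<^sup>0\<^sup>)\<close> from the origin is itself a Markov chain, because
  \<open>\<phi>\<^sub>0\<close> is radial and every vertex other than the origin has exactly one neighbour closer to it. As
  \<open>q\<close> tends to infinity, its transition probabilities tend to \<open>(m' + 1) / (2 * (m + 1))\<close> from \<open>m\<close> to
  \<open>m' = m \<pm> 1\<close>, and these factors telescope to \<open>(d n + 1) / 2 ^ n\<close>.

  Ground state of a ray. Let \<open>\<omega> k\<close> be the projection of \<open>x\<close> to the ray and \<open>j\<close> the distance from \<open>x\<close> to
  it, so that \<open>d(o,x) = k + j\<close> and \<open>h(x) = j - k\<close>. The height of \<open>S\<close> is a simple symmetric random
  walk: one neighbour of \<open>x\<close> is lower and has probability \<open>1/2\<close>, and each of the other \<open>q\<close> is higher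
  and has probability \<open>1/(2q)\<close>. On the ray, stepping back along it is one of these higher neighbours
  and disappears in the limit. Hence in the limit \<open>k\<close> increases exactly when \<open>-h\<close> reaches a new
  maximum, that is, \<open>k\<close> is the running maximum of \<open>-h\<close>, and \<open>d(o,x) = 2k - (-h)\<close>. So the pair
  (\<open>k\<close>, distance) has, in the limit, the transition kernel (\<open>pitman_kernel\<close>) of the pair (running
  maximum of \<open>\<Sigma>\<close>, twice that maximum minus \<open>\<Sigma>\<close>).

  Pitman's theorem. This kernel has the property that, for each admissible target pair
  \<open>(k', d')\<close> and each \<open>d\<close> adjacent to \<open>d'\<close>, exactly one \<open>k \<le> d\<close> leads there. By induction, for a fixed path
  \<open>d\<close>, each of the \<open>d n + 1\<close> values \<open>k \<le> d n\<close> has joint probability \<open>1 / 2 ^ n\<close> with \<open>d\<close>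
  (\<open>bessel_path_weight_limit\<close>). This one computation serves both \<open>S\<close>, as a limit, and \<open>\<Sigma>\<close>, exactly.

  Finally, convergence of path probabilities gives weak convergence of whole trajectories
  (\<open>converges_in_law_if_paths\<close>): the trajectories stay in the compact box \<open>\<Prod>n. {0..n}\<close>, on which a
  continuous functional is uniformly close to one that depends on finitely many coordinates.\<close>

section \<open>Distances in a tree\<close>

text \<open>The empty list is excluded, so that every walk has an end point. The walks below are listed from their
  end point back to their starting point, so that prolonging a walk is a cons.\<close>

fun nb_walk :: "('v \<Rightarrow> 'v \<Rightarrow> bool) \<Rightarrow> 'v list \<Rightarrow> bool" where
  "nb_walk E [] \<longleftrightarrow> False"
| "nb_walk E [x] \<longleftrightarrow> True"
| "nb_walk E (x # y # zs) \<longleftrightarrow> E x y \<and> nb_walk E (y # zs) \<and> (zs = [] \<or> hd zs \<noteq> x)"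

lemma successively_if_nb_walk: "nb_walk E xs \<Longrightarrow> successively E xs"
  by (induction E xs rule: nb_walk.induct) auto

lemma relpowp_sym:
  assumes "\<And>x y. E x y \<Longrightarrow> E y x" and "(E ^^ n) x y"
  shows "(E ^^ n) y x"
  using assms(2)
proof (induction n arbitrary: y)
  case (Suc n)
  then obtain z where "(E ^^ n) x z" "E z y" by (auto elim: relpowp_Suc_E)
  then show ?case using Suc.IH assms(1) by (meson relpowp_Suc_I2)
qed auto

locale tree =
  fixes V :: "'v set" and E :: "'v \<Rightarrow> 'v \<Rightarrow> bool"
  assumes simple: "simple_graph V E"
    and connected: "graph_connected V E"
    and acyclic: "graph_acyclic E"
begin

lemma edgeD: "E x y \<Longrightarrow> x \<in> V" "E x y \<Longrightarrow> y \<in> V" "E x y \<Longrightarrow> x \<noteq> y" "E x y \<Longrightarrow> E y x"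
  using simple unfolding simple_graph_def by blast+

text \<open>A first return to \<open>x\<close> would close a cycle; it has length at least three because the walk does not
  backtrack at \<open>x\<close>.\<close>

lemma distinct_if_nb_walk: "nb_walk E xs \<Longrightarrow> distinct xs"
proof (induction xs rule: induct_list012)
  case (3 x y zs)
  have dist: "distinct (y # zs)" and Exy: "E x y" using 3 by auto
  have "x \<notin> set zs"
  proof
    assume "x \<in> set zs"
    then obtain us vs where zs: "zs = us @ x # vs" by (meson split_list)
    have "us \<noteq> []" using 3(3) zs by auto
    let ?c = "y # us @ [x]"
    have "successively E (y # zs)" using 3(3) successively_if_nb_walk by auto
    then have "successively E (?c @ vs)" by (simp add: zs)
    then have "successively E ?c" unfolding successively_append_iff by simp
    moreover have "distinct ?c" using dist zs by auto
    moreover have "3 \<le> length ?c" using \<open>us \<noteq> []\<close> by (cases us) auto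
    moreover have "E (last ?c) (hd ?c)" using Exy by simp
    ultimately show False using acyclic unfolding graph_acyclic_def by blast
  qed
  then show ?case using dist edgeD(3)[OF Exy] by auto
qed auto

text \<open>The second list continues the first, reversed, across their common edge, so that no backtracking
  occurs at the junction.\<close>

lemma nb_walk_join:
  "nb_walk E (a # b # us) \<Longrightarrow> nb_walk E (b # a # vs) \<Longrightarrow> nb_walk E (rev us @ b # a # vs)"
proof (induction us arbitrary: a b vs)
  case (Cons c us)
  then have "nb_walk E (b # c # us)" "nb_walk E (c # b # a # vs)"
    using edgeD(4) by auto
  then show ?case using Cons.IH[of b c "a # vs"] by simp
qed auto

text \<open>Two different walks from the same vertex to \<open>x\<close> can be cut at the last vertex at which they agree and
  joined there into a non-backtracking walk that visits the starting vertex twice.\<close>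

lemma nb_walk_unique:
  assumes "nb_walk E (x # ps)" "nb_walk E (x # qs)" "last (x # ps) = last (x # qs)"
  shows "ps = qs"
  using assms
proof (induction ps arbitrary: x qs)
  case Nil
  then show ?case using distinct_if_nb_walk[OF Nil(2)] by (auto split: if_splits)
next
  case (Cons p ps)
  show ?case
  proof (cases qs)
    case Nil
    then show ?thesis using distinct_if_nb_walk[OF Cons.prems(1)] Cons.prems(3)
      by (metis distinct.simps(2) last.simps last_in_set list.distinct(1))
  next
    case (Cons q qs')
    show ?thesis
    proof (cases "p = q")
      case True
      have "ps = qs'"
        by (rule Cons.IH[of q]) (use Cons.prems True Cons in auto)
      then show ?thesis using True Cons by simp
    next
      case False
      have "nb_walk E (p # x # q # qs')" using Cons.prems False Cons edgeD(4) by auto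
      then have "nb_walk E (rev ps @ p # x # q # qs')"
        using Cons.prems(1) nb_walk_join by blast
      then have d: "distinct (rev ps @ p # x # q # qs')" by (rule distinct_if_nb_walk)
      have "last (p # ps) = last (q # qs')" using Cons.prems(3) Cons by simp
      moreover have "last (p # ps) \<in> set (p # ps)" "last (q # qs') \<in> set (q # qs')"
        by (rule last_in_set, simp)+
      ultimately show ?thesis using d by auto
    qed
  qed
qed

lemma nb_walk_step:
  assumes "nb_walk E (x # ps)" "E x y"
  obtains qs where "ps = y # qs" "nb_walk E (y # qs)" "last (y # qs) = last (x # ps)"
  | "nb_walk E (y # x # ps)" "last (y # x # ps) = last (x # ps)" "ps = [] \<or> hd ps \<noteq> y"
proof (cases "ps \<noteq> [] \<and> hd ps = y")
  case True
  then obtain qs where "ps = y # qs" by (cases ps) auto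
  then show ?thesis using that(1) assms(1) by auto
next
  case False
  then show ?thesis using that(2) assms edgeD(4) by (cases ps) auto
qed

lemma nb_walk_exists:
  assumes "E\<^sup>*\<^sup>* a x"
  shows "\<exists>ps. nb_walk E (x # ps) \<and> last (x # ps) = a"
  using assms
proof induction
  case base
  then show ?case by (intro exI[of _ "[]"]) auto
next
  case (step x y)
  then obtain ps where "nb_walk E (x # ps)" "last (x # ps) = a" by blast
  then show ?case using step.hyps(2) by (metis nb_walk_step)
qed

text \<open>Along any edge the length of the non-backtracking walk from \<open>a\<close> changes by exactly one, so no walk
  with fewer edges reaches \<open>x\<close>.\<close>

lemma graph_dist_eq_length:
  assumes "nb_walk E (x # ps)" "last (x # ps) = a"
  shows "graph_dist E a x = length ps"
  unfolding graph_dist_def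
proof (rule Least_equality)
  show "(E ^^ length ps) a x"
    using assms
  proof (induction ps arbitrary: x)
    case (Cons p ps)
    then have "(E ^^ length ps) a p" "E p x" using edgeD(4) by auto
    then show ?case by auto
  qed auto
next
  fix n assume "(E ^^ n) a x"
  then show "length ps \<le> n" using assms
  proof (induction n arbitrary: x ps)
    case 0
    then have "last (x # ps) = last [x]" by simp
    then have "ps = []" by (intro nb_walk_unique[OF 0(2)]) simp_all
    then show ?case by simp
  next
    case (Suc n)
    then obtain y where y: "(E ^^ n) a y" "E y x" by (auto elim: relpowp_Suc_E)
    then obtain qs where qs: "nb_walk E (y # qs)" "last (y # qs) = a"
      using nb_walk_exists by (meson relpowp_imp_rtranclp)
    have le: "length qs \<le> n" using Suc.IH[OF y(1) qs] .
    from qs(1) y(2) show ?case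
    proof (cases rule: nb_walk_step)
      case (1 rs)
      then have "ps = rs" using nb_walk_unique Suc.prems qs by metis
      then show ?thesis using le 1 by simp
    next
      case 2
      then have "ps = y # qs" using nb_walk_unique Suc.prems qs by metis
      then show ?thesis using le by simp
    qed
  qed
qed

lemma graph_dist_sym: "graph_dist E x y = graph_dist E y x"
  unfolding graph_dist_def using relpowp_sym[of E] edgeD(4) by metis

lemma graph_dist_self [simp]: "graph_dist E x x = 0"
  unfolding graph_dist_def by (rule Least_equality) auto

lemma relpowp_graph_dist:
  assumes "x \<in> V" "y \<in> V" shows "(E ^^ graph_dist E x y) x y"
proof -
  have "\<exists>n. (E ^^ n) x y"
    using connected assms unfolding graph_connected_def by (meson rtranclp_imp_relpowp)
  then show ?thesis unfolding graph_dist_def by (rule LeastI_ex)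
qed

lemma graph_dist_eq_0_iff:
  assumes "x \<in> V" "y \<in> V" shows "graph_dist E x y = 0 \<longleftrightarrow> x = y"
  using relpowp_graph_dist[OF assms] by (metis graph_dist_self relpowp_0_E)

lemma graph_dist_triangle:
  assumes "x \<in> V" "y \<in> V" "z \<in> V"
  shows "graph_dist E x z \<le> graph_dist E x y + graph_dist E y z"
proof -
  have "(E ^^ (graph_dist E x y + graph_dist E y z)) x z"
    unfolding relpowp_add using relpowp_graph_dist assms by blast
  then show ?thesis unfolding graph_dist_def[of E x z] by (rule Least_le)
qed

lemma graph_dist_edge:
  assumes "E x y" shows "graph_dist E x y = 1"
  using graph_dist_eq_length[of y "[x]" x] assms edgeD(4) by auto

text \<open>The closer neighbour is the last but one vertex of the walk from \<open>a\<close> to \<open>x\<close>; a step to any other neighbour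
  prolongs that walk without backtracking.\<close>

lemma unique_closer_neighbour:
  assumes "a \<in> V" "x \<in> V" "x \<noteq> a"
  obtains p where "E x p" "Suc (graph_dist E a p) = graph_dist E a x"
    "\<And>y. E x y \<Longrightarrow> y \<noteq> p \<Longrightarrow> graph_dist E a y = Suc (graph_dist E a x)"
proof -
  obtain ps where ps: "nb_walk E (x # ps)" "last (x # ps) = a"
    using nb_walk_exists connected assms unfolding graph_connected_def by meson
  then obtain p qs where p: "ps = p # qs" using assms(3) by (cases ps) auto
  have d: "graph_dist E a x = length ps" using graph_dist_eq_length ps by blast
  show ?thesis
  proof
    show "E x p" using ps p by auto
    have "graph_dist E a p = length qs" by (rule graph_dist_eq_length) (use ps p in auto)
    then show "Suc (graph_dist E a p) = graph_dist E a x" using d p by simp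
  next
    fix y assume "E x y" "y \<noteq> p"
    with ps(1) have "graph_dist E a y = length (x # ps)"
    proof (cases rule: nb_walk_step)
      case 1 then show ?thesis using p \<open>y \<noteq> p\<close> by auto
    next
      case 2 then show ?thesis using graph_dist_eq_length ps(2) by metis
    qed
    then show "graph_dist E a y = Suc (graph_dist E a x)" using d by simp
  qed
qed

end

lemma homogeneous_tree_imp_tree: "homogeneous_tree q V E \<Longrightarrow> tree V E"
  unfolding homogeneous_tree_def by unfold_locales auto

context tree begin

lemma countable_if_locally_finite:
  assumes fin: "\<And>x. x \<in> V \<Longrightarrow> finite {y. E x y}"
  shows "countable V"
proof (cases "V = {}")
  case False
  then obtain r where r: "r \<in> V" by blast
  have fin': "finite {y. (E ^^ n) r y}" for n
  proof (induction n)
    case (Suc n)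
    have "finite (\<Union>x\<in>{x. (E ^^ n) r x}. {y. E x y})"
      using Suc fin edgeD(1) by (metis (no_types, lifting) Collect_empty_eq finite.emptyI finite_UN)
    then show ?case by (rule finite_subset[rotated]) auto
  qed auto
  have "V \<subseteq> (\<Union>n. {y. (E ^^ n) r y})" using relpowp_graph_dist[OF r] by blast
  then show ?thesis
    by (rule countable_subset) (auto intro: countable_finite fin')
qed auto

end

lemma homogeneous_tree_degree:
  assumes "homogeneous_tree q V E" "x \<in> V"
  shows "card {y. E x y} = q + 1" "finite {y. E x y}"
proof -
  show c: "card {y. E x y} = q + 1" using assms unfolding homogeneous_tree_def by blast
  show "finite {y. E x y}" by (rule card_ge_0_finite) (simp add: c)
qed

lemma homogeneous_tree_countable: "homogeneous_tree q V E \<Longrightarrow> countable V"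
  using tree.countable_if_locally_finite homogeneous_tree_imp_tree homogeneous_tree_degree(2)
  by metis

section \<open>Coordinates relative to a ray\<close>

text \<open>The vertex \<open>x\<close> hangs off the ray at \<open>\<omega> k\<close>, at depth \<open>j\<close>. Prescribing the distances to all vertices
  of the ray identifies the projection and lets the coordinates of a neighbour be computed from the distance
  functions of the single vertices \<open>\<omega> m\<close>.\<close>

definition ray_coords ::
  "('v \<Rightarrow> 'v \<Rightarrow> bool) \<Rightarrow> (nat \<Rightarrow> 'v) \<Rightarrow> 'v \<Rightarrow> nat \<Rightarrow> nat \<Rightarrow> bool" where
  "ray_coords E \<omega> x k j \<longleftrightarrow> (\<forall>m. graph_dist E (\<omega> m) x = j + nat \<bar>int m - int k\<bar>)"

locale tree_ray = tree +
  fixes r :: 'a and \<omega> :: "nat \<Rightarrow> 'a"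
  assumes ray: "geodesic_ray V E r \<omega>"
begin

lemma ray_in_V: "\<omega> n \<in> V" and ray_inj: "inj \<omega>" and ray_0: "\<omega> 0 = r"
  using ray unfolding geodesic_ray_def by auto

lemma ray_edge: "E (\<omega> n) (\<omega> (Suc n))"
proof -
  have "graph_dist E (\<omega> n) (\<omega> (Suc n)) = 1" using ray unfolding geodesic_ray_def by auto
  then have "(E ^^ 1) (\<omega> n) (\<omega> (Suc n))" using relpowp_graph_dist ray_in_V by metis
  then show ?thesis by auto
qed

lemma graph_dist_ray_add: "graph_dist E (\<omega> m) (\<omega> (m + n)) = n"
proof -
  let ?w = "\<lambda>n. map \<omega> (rev [m..<m + Suc n])"
  have w: "nb_walk E (?w n)" for n
  proof (induction n)
    case (Suc n)
    have "\<omega> (Suc (m + n)) \<noteq> \<omega> (m + n - 1)" using ray_inj by (auto dest: injD)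
    then show ?case using Suc ray_edge edgeD(4) by (cases n) auto
  qed auto
  have "graph_dist E (\<omega> m) (\<omega> (m + n)) = length (map \<omega> (rev [m..<m + n]))"
  proof (rule graph_dist_eq_length)
    show "nb_walk E (\<omega> (m + n) # map \<omega> (rev [m..<m + n]))" using w[of n] by simp
    show "last (\<omega> (m + n) # map \<omega> (rev [m..<m + n])) = \<omega> m"
      by (cases n) (auto simp: last_map last_rev upt_conv_Cons)
  qed
  then show ?thesis by simp
qed

lemma ray_coords_ray: "ray_coords E \<omega> (\<omega> k) k 0"
  unfolding ray_coords_def
proof
  fix m
  show "graph_dist E (\<omega> m) (\<omega> k) = 0 + nat \<bar>int m - int k\<bar>"
  proof (cases "m \<le> k")
    case True
    then show ?thesis using graph_dist_ray_add[of m "k - m"] by simp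
  next
    case False
    then show ?thesis using graph_dist_ray_add[of k "m - k"] graph_dist_sym[of "\<omega> m"] by simp
  qed
qed

lemma ray_coords_0_iff:
  assumes "x \<in> V" shows "ray_coords E \<omega> x k 0 \<longleftrightarrow> x = \<omega> k"
proof
  assume "ray_coords E \<omega> x k 0"
  then have "graph_dist E (\<omega> k) x = 0" unfolding ray_coords_def by simp
  then show "x = \<omega> k" using graph_dist_eq_0_iff ray_in_V assms by metis
qed (simp add: ray_coords_ray)

text \<open>The neighbour that is closer to \<open>\<omega> k\<close> is, by the triangle inequality, closer to every \<open>\<omega> m\<close>, hence it
  is the unique closer neighbour for all \<open>m\<close> at once.\<close>

lemma ray_coords_step_off:
  assumes x: "x \<in> V" and c: "ray_coords E \<omega> x k (Suc j)"
  obtains p where "E x p" "ray_coords E \<omega> p k j"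
    "\<And>y. E x y \<Longrightarrow> y \<noteq> p \<Longrightarrow> ray_coords E \<omega> y k (Suc (Suc j))"
proof -
  have d: "graph_dist E (\<omega> m) x = Suc j + nat \<bar>int m - int k\<bar>" for m
    using c unfolding ray_coords_def by blast
  have ne: "x \<noteq> \<omega> m" for m using d[of m] by auto
  obtain p where p: "E x p" "Suc (graph_dist E (\<omega> k) p) = graph_dist E (\<omega> k) x"
    by (rule unique_closer_neighbour[OF ray_in_V[of k] x ne]) blast
  have p_m: "graph_dist E (\<omega> m) p = j + nat \<bar>int m - int k\<bar> \<and>
    (\<forall>y. E x y \<longrightarrow> y \<noteq> p \<longrightarrow> graph_dist E (\<omega> m) y = Suc (Suc j) + nat \<bar>int m - int k\<bar>)" for m
  proof -
    have "graph_dist E (\<omega> m) p \<le> graph_dist E (\<omega> m) (\<omega> k) + graph_dist E (\<omega> k) p"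
      by (rule graph_dist_triangle) (use ray_in_V p(1) edgeD in auto)
    also have "\<dots> = nat \<bar>int m - int k\<bar> + j"
      using ray_coords_ray[of k] p(2) d[of k] unfolding ray_coords_def by simp
    finally have le: "graph_dist E (\<omega> m) p < graph_dist E (\<omega> m) x" using d[of m] by simp
    obtain p' where p': "E x p'" "Suc (graph_dist E (\<omega> m) p') = graph_dist E (\<omega> m) x"
      "\<And>y. E x y \<Longrightarrow> y \<noteq> p' \<Longrightarrow> graph_dist E (\<omega> m) y = Suc (graph_dist E (\<omega> m) x)"
      by (rule unique_closer_neighbour[OF ray_in_V[of m] x ne]) blast
    then have "p' = p" using le p(1) by fastforce
    then show ?thesis using p' d[of m] by auto
  qed
  show ?thesis
    by (rule that[OF p(1)]) (use p_m in \<open>auto simp: ray_coords_def\<close>)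
qed

text \<open>Seen from \<open>\<omega> m\<close> with \<open>m \<noteq> k\<close>, the closer neighbour of \<open>\<omega> k\<close> is its neighbour on the ray in the
  direction of \<open>\<omega> m\<close>; all others are farther away.\<close>

lemma ray_coords_step_on:
  assumes y: "E (\<omega> k) y" "y \<noteq> \<omega> (Suc k)" "k > 0 \<Longrightarrow> y \<noteq> \<omega> (k - 1)"
  shows "ray_coords E \<omega> y k 1"
  unfolding ray_coords_def
proof
  fix m
  show "graph_dist E (\<omega> m) y = 1 + nat \<bar>int m - int k\<bar>"
  proof (cases "m = k")
    case True
    then show ?thesis using graph_dist_edge[OF y(1)] by simp
  next
    case False
    have d: "graph_dist E (\<omega> m) (\<omega> i) = nat \<bar>int m - int i\<bar>" for i
      using ray_coords_ray unfolding ray_coords_def by simp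
    have ne: "\<omega> k \<noteq> \<omega> m" using False ray_inj by (auto dest: injD)
    obtain p where p: "E (\<omega> k) p" 
      "\<And>y. E (\<omega> k) y \<Longrightarrow> y \<noteq> p \<Longrightarrow> graph_dist E (\<omega> m) y = Suc (graph_dist E (\<omega> m) (\<omega> k))"
      by (rule unique_closer_neighbour[OF ray_in_V[of m] ray_in_V ne]) blast
    define i where "i = (if m < k then k - 1 else Suc k)"
    have "E (\<omega> k) (\<omega> i)"
      using ray_edge[of k] ray_edge[of "k - 1"] edgeD(4) unfolding i_def by auto
    moreover have "graph_dist E (\<omega> m) (\<omega> i) < graph_dist E (\<omega> m) (\<omega> k)"
      unfolding d i_def using False by auto
    ultimately have "p = \<omega> i" using p(2)[of "\<omega> i"] by fastforce
    moreover have "y \<noteq> \<omega> i" using y(2,3) unfolding i_def by auto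
    ultimately show ?thesis using p(2)[OF y(1)] d[of k] by simp
  qed
qed

lemma ray_coords_exists:
  assumes "x \<in> V" obtains k j where "ray_coords E \<omega> x k j"
proof -
  have "E\<^sup>*\<^sup>* r x" 
    using connected assms ray_0 ray_in_V unfolding graph_connected_def by metis
  then have "\<exists>k j. ray_coords E \<omega> x k j"
  proof induction
    case base
    then show ?case using ray_coords_ray ray_0 by metis
  next
    case (step x y)
    then obtain k j where c: "ray_coords E \<omega> x k j" by blast
    show ?case
    proof (cases j)
      case 0
      then show ?thesis 
        using c ray_coords_0_iff edgeD(1)[OF step.hyps(2)] ray_coords_step_on ray_coords_ray step.hyps(2)
        by metis
    next
      case (Suc i)
      then show ?thesis using c ray_coords_step_off edgeD(1)[OF step.hyps(2)] step.hyps(2) by metis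
    qed
  qed
  then show ?thesis using that by blast
qed

lemma ray_proj_eq:
  assumes "ray_coords E \<omega> x k j" shows "ray_proj E \<omega> x = \<omega> k"
  unfolding ray_proj_def
proof (rule the_equality)
  have d: "graph_dist E x (\<omega> m) = j + nat \<bar>int m - int k\<bar>" for m
    using assms graph_dist_sym unfolding ray_coords_def by metis
  then show "\<omega> k \<in> range \<omega> \<and> (\<forall>z\<in>range \<omega>. graph_dist E x (\<omega> k) \<le> graph_dist E x z)"
    by auto
  fix y assume "y \<in> range \<omega> \<and> (\<forall>z\<in>range \<omega>. graph_dist E x y \<le> graph_dist E x z)"
  then obtain m where "y = \<omega> m" "graph_dist E x (\<omega> m) \<le> graph_dist E x (\<omega> k)" by blast
  then show "y = \<omega> k" using d by simp
qed

lemma ray_coords_dist: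
  assumes "ray_coords E \<omega> x k j"
  shows "graph_dist E r x = k + j" "graph_dist E r (ray_proj E \<omega> x) = k"
    "graph_dist E x (ray_proj E \<omega> x) = j" "ray_height E r \<omega> x = int j - int k"
proof -
  show 1: "graph_dist E r x = k + j" using assms ray_0 unfolding ray_coords_def
    by (metis abs_minus abs_of_nat add.commute diff_0 nat_int of_nat_0)
  show 2: "graph_dist E r (ray_proj E \<omega> x) = k"
    using ray_proj_eq[OF assms] graph_dist_ray_add[of 0 k] ray_0 by simp
  show 3: "graph_dist E x (ray_proj E \<omega> x) = j"
    using assms ray_proj_eq[OF assms] graph_dist_sym unfolding ray_coords_def by simp
  show "ray_height E r \<omega> x = int j - int k"
    unfolding ray_height_def 2 3 ..
qed

end

section \<open>Steps of Markov chains and of ground state processes\<close>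

lemma measurable_markov_chain_pred:
  assumes "markov_chain M V x0 p X"
  shows "Measurable.pred M (\<lambda>w. P (X n w))"
proof -
  have "X n \<in> M \<rightarrow>\<^sub>M count_space V" using assms unfolding markov_chain_def by blast
  then show ?thesis by (rule measurable_compose) simp
qed

text \<open>Both \<open>Q\<close> and \<open>R\<close> may depend on the whole past. With \<open>R\<close> depending only on a function of the next
  state this is the lumping criterion for Markov chains; for the running maximum of a walk the
  dependence on the past is essential. Countability of \<open>V\<close> makes the past a countable disjoint union of
  cylinder events.\<close>

lemma markov_chain_one_step:
  fixes p :: "'s \<Rightarrow> 's \<Rightarrow> real" and n :: nat
  defines "pre \<equiv> \<lambda>X w. restrict (\<lambda>k. X k w) {..n}"
  assumes mc: "markov_chain M V x0 p X" and V: "countable V"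
    and nonneg: "\<And>x y. x \<in> V \<Longrightarrow> y \<in> V \<Longrightarrow> 0 \<le> p x y"
    and fin: "\<And>x. x \<in> V \<Longrightarrow> finite {y \<in> V. p x y \<noteq> 0}"
    and row: "\<And>x. x \<in> {..n} \<rightarrow>\<^sub>E V \<Longrightarrow> Q x \<Longrightarrow>
      (\<Sum>y | y \<in> V \<and> p (x n) y \<noteq> 0 \<and> R x y. p (x n) y) = c"
  shows "\<P>(w in M. Q (pre X w) \<and> R (pre X w) (X (Suc n) w)) = c * \<P>(w in M. Q (pre X w))"
proof -
  interpret prob_space M using mc unfolding markov_chain_def by blast
  have XV: "X k w \<in> V" if "w \<in> space M" for k w
    using mc that unfolding markov_chain_def by (auto dest!: spec[of _ k] measurable_space)
  note [measurable] = measurable_markov_chain_pred[OF mc]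
  define A where "A x = {w \<in> space M. \<forall>k\<le>n. X k w = x k}" for x
  define B where "B x = {w \<in> space M. (\<forall>k\<le>n. X k w = x k) \<and> R x (X (Suc n) w)}" for x
  define F where "F = {x \<in> {..n} \<rightarrow>\<^sub>E V. Q x}"
  have [measurable]: "A x \<in> sets M" "B x \<in> sets M" for x
    unfolding A_def B_def by measurable
  have F: "countable F"
    unfolding F_def by (rule countable_subset[OF _ countable_PiE[of "{..n}" "\<lambda>_. V"]]) (use V in auto)
  have pre: "pre X w \<in> {..n} \<rightarrow>\<^sub>E V" if "w \<in> space M" for w
    using XV[OF that] unfolding pre_def by auto
  have pre_eq: "pre X w = x" if "x \<in> F" "\<forall>k\<le>n. X k w = x k" for x w
    using that unfolding pre_def F_def by (auto simp: PiE_def extensional_def fun_eq_iff)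
  have B: "emeasure M (B x) = ennreal c * emeasure M (A x)" if x: "x \<in> F" for x
  proof -
    let ?R = "{y \<in> V. R x y}" and ?C = "\<lambda>y. {w \<in> space M. (\<forall>k\<le>n. X k w = x k) \<and> X (Suc n) w = y}"
    let ?S = "{y. y \<in> V \<and> p (x n) y \<noteq> 0 \<and> R x y}"
    have xn: "x n \<in> V" using x unfolding F_def by auto
    \<comment> \<open>The Markov property says nothing about cylinders of probability zero, where both sides vanish.\<close>
  have C: "prob (?C y) = prob (A x) * p (x n) y" if y: "y \<in> V" for y
    proof (cases "prob (A x) > 0")
      case True
      then have "cond_prob M (\<lambda>w. X (Suc n) w = y) (\<lambda>w. \<forall>k\<le>n. X k w = x k) = p (x n) y"
        using mc y unfolding markov_chain_def A_def by blast
      then show ?thesis using True unfolding cond_prob_def A_def by (simp add: field_simps conj_commute)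
    next
      case False
      then have "prob (A x) = 0" using measure_nonneg[of M "A x"] by linarith
      moreover have "prob (?C y) \<le> prob (A x)"
        by (rule finite_measure_mono) (auto simp: A_def intro: \<open>A x \<in> sets M\<close>[unfolded A_def])
      ultimately show ?thesis using measure_nonneg[of M "?C y"] by simp
    qed
    have "B x = (\<Union>y\<in>?R. ?C y)" unfolding B_def using XV by auto
    also have "emeasure M \<dots> = (\<integral>\<^sup>+y. emeasure M (?C y) \<partial>count_space ?R)"
      by (rule emeasure_UN_countable) (use V in \<open>auto simp: disjoint_family_on_def\<close>)
    also have "\<dots> = (\<integral>\<^sup>+y. ennreal (prob (A x) * p (x n) y) \<partial>count_space ?R)"
      by (rule nn_integral_cong) (simp add: emeasure_eq_measure C)
    also have "\<dots> = (\<Sum>y\<in>?S. ennreal (prob (A x) * p (x n) y))"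
      by (rule nn_integral_count_space') (use finite_subset[OF _ fin[OF xn]] in \<open>auto intro: finite_subset[OF _ fin[OF xn]]\<close>)
    also have "\<dots> = ennreal (\<Sum>y\<in>?S. prob (A x) * p (x n) y)"
      by (rule sum_ennreal) (use nonneg xn in auto)
    also have "(\<Sum>y\<in>?S. prob (A x) * p (x n) y) = c * prob (A x)"
      using row[of x] x unfolding F_def by (simp add: sum_distrib_left[symmetric] mult.commute)
    also have "ennreal (c * prob (A x)) = ennreal c * ennreal (prob (A x))"
      by (rule ennreal_mult'') simp
    finally show ?thesis by (simp add: emeasure_eq_measure)
  qed
  have eqA: "{w \<in> space M. Q (pre X w)} = (\<Union>x\<in>F. A x)"
  proof (intro equalityI subsetI)
    fix w assume w: "w \<in> {w \<in> space M. Q (pre X w)}"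
    then have "pre X w \<in> F" "w \<in> A (pre X w)"
      using pre unfolding F_def A_def by (auto simp: pre_def)
    then show "w \<in> (\<Union>x\<in>F. A x)" by blast
  qed (use pre_eq in \<open>auto simp: A_def F_def\<close>)
  have eqB: "{w \<in> space M. Q (pre X w) \<and> R (pre X w) (X (Suc n) w)} = (\<Union>x\<in>F. B x)"
  proof (intro equalityI subsetI)
    fix w assume w: "w \<in> {w \<in> space M. Q (pre X w) \<and> R (pre X w) (X (Suc n) w)}"
    then have "pre X w \<in> F" "w \<in> B (pre X w)"
      using pre unfolding F_def B_def by (auto simp: pre_def)
    then show "w \<in> (\<Union>x\<in>F. B x)" by blast
  next
    fix w assume "w \<in> (\<Union>x\<in>F. B x)"
    then obtain x where "x \<in> F" "w \<in> B x" by blast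
    then show "w \<in> {w \<in> space M. Q (pre X w) \<and> R (pre X w) (X (Suc n) w)}"
      using pre_eq[of x w] unfolding B_def F_def by auto
  qed
  have disj: "disjoint_family_on A F" "disjoint_family_on B F"
  proof -
    have "A x \<inter> A y = {} \<and> B x \<inter> B y = {}" if "x \<in> F" "y \<in> F" "x \<noteq> y" for x y
    proof -
      have "\<not> ((\<forall>k\<le>n. X k w = x k) \<and> (\<forall>k\<le>n. X k w = y k))" for w
        using pre_eq[of x w] pre_eq[of y w] that by blast
      then show ?thesis unfolding A_def B_def by blast
    qed
    then show "disjoint_family_on A F" "disjoint_family_on B F"
      unfolding disjoint_family_on_def by blast+
  qed
  have "emeasure M (\<Union>x\<in>F. B x) = (\<integral>\<^sup>+x. emeasure M (B x) \<partial>count_space F)"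
    by (rule emeasure_UN_countable) (use F disj in auto)
  also have "\<dots> = (\<integral>\<^sup>+x. ennreal c * emeasure M (A x) \<partial>count_space F)"
    by (rule nn_integral_cong) (simp add: B)
  also have "\<dots> = ennreal c * (\<integral>\<^sup>+x. emeasure M (A x) \<partial>count_space F)"
    by (rule nn_integral_cmult) simp
  also have "(\<integral>\<^sup>+x. emeasure M (A x) \<partial>count_space F) = emeasure M (\<Union>x\<in>F. A x)"
    by (rule emeasure_UN_countable[symmetric]) (use F disj in auto)
  finally have eq: "emeasure M (\<Union>x\<in>F. B x) = ennreal c * emeasure M (\<Union>x\<in>F. A x)" .
  show ?thesis
  proof (cases "F = {}")
    case True
    then show ?thesis unfolding eqA eqB by simp
  next
    case False
    then obtain x where x: "x \<in> F" by blast
    then have "0 \<le> c" using row[of x] nonneg unfolding F_def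
      by (smt (verit) PiE_mem atMost_iff dual_order.refl mem_Collect_eq sum_nonneg)
    then show ?thesis using eq unfolding eqA eqB
      by (simp add: emeasure_eq_measure ennreal_mult'[symmetric])
  qed
qed

lemma ground_chain_one_step:
  assumes q: "1 \<le> q" and T: "homogeneous_tree q V E" and \<phi>: "\<And>x. x \<in> V \<Longrightarrow> 0 < \<phi> x"
    and mc: "markov_chain M V r (ground_trans q E \<phi>) X"
    and row: "\<And>x. x \<in> {..n} \<rightarrow>\<^sub>E V \<Longrightarrow> Q x \<Longrightarrow>
      (\<Sum>y | E (x n) y \<and> R y. ground_trans q E \<phi> (x n) y) = c"
  shows "\<P>(w in M. Q (restrict (\<lambda>k. X k w) {..n}) \<and> R (X (Suc n) w)) =
    c * \<P>(w in M. Q (restrict (\<lambda>k. X k w) {..n}))"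
proof -
  interpret tree V E by (rule homogeneous_tree_imp_tree[OF T])
  have 0: "ground_trans q E \<phi> x y \<noteq> 0 \<longleftrightarrow> E x y" "0 \<le> ground_trans q E \<phi> x y"
    if "x \<in> V" "y \<in> V" for x y
    using \<phi>[OF that(1)] \<phi>[OF that(2)] q by (auto simp: ground_trans_def srw_trans_def spec_rad_def)
  then have S: "{y \<in> V. ground_trans q E \<phi> x y \<noteq> 0 \<and> P y} = {y. E x y \<and> P y}" if "x \<in> V" for x P
    using edgeD(2) that by blast
  show ?thesis
  proof (rule markov_chain_one_step[OF mc homogeneous_tree_countable[OF T] 0(2)])
    fix x assume x: "x \<in> V"
    show "finite {y \<in> V. ground_trans q E \<phi> x y \<noteq> 0}"
      using S[OF x, of "\<lambda>_. True"] homogeneous_tree_degree(2)[OF T x] by simp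
  next
    fix x assume x: "x \<in> {..n} \<rightarrow>\<^sub>E V" "Q x"
    then have "x n \<in> V" by auto
    then show "(\<Sum>y | y \<in> V \<and> ground_trans q E \<phi> (x n) y \<noteq> 0 \<and> R y. ground_trans q E \<phi> (x n) y) = c"
      using S row[OF x] by simp
  qed
qed

lemma ground_chain_radius_start:
  assumes T: "homogeneous_tree q V E" and mc: "markov_chain M V r p X"
  shows "AE w in M. graph_dist E r (X 0 w) = 0"
proof -
  interpret tree V E by (rule homogeneous_tree_imp_tree[OF T])
  have "AE w in M. X 0 w = r" using mc unfolding markov_chain_def by blast
  then show ?thesis by eventually_elim simp
qed

lemma measurable_markov_chain_fun:
  assumes "markov_chain M V x0 p X"
  shows "(\<lambda>w. g (X n w)) \<in> M \<rightarrow>\<^sub>M count_space UNIV"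
proof -
  have "X n \<in> M \<rightarrow>\<^sub>M count_space V" using assms unfolding markov_chain_def by blast
  then show ?thesis by (rule measurable_compose) simp
qed

text \<open>With \<open>x\<close>, \<open>y\<close> adjacent and ground state values \<open>A * q powr (- a / 2)\<close> and \<open>B * q powr (- b / 2)\<close>, this is
  the transition probability from \<open>x\<close> to \<open>y\<close>; both ground states have this form.\<close>

lemma powr_half_step:
  assumes "1 \<le> (q::nat)"
  shows "1 / (real q + 1) * (B * real q powr (- b / 2)) / (spec_rad q * (A * real q powr (- a / 2)))
    = B / (2 * A) * real q powr ((a - b - 1) / 2)"
proof -
  have "real q powr (- b / 2) = real q powr ((a - b - 1) / 2) * (real q powr (1 / 2) * real q powr (- a / 2))"
    by (simp add: powr_add[symmetric] field_simps)
  also have "real q powr (1 / 2) = sqrt q" by (simp add: powr_half_sqrt)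
  finally have eq: "real q powr (- b / 2) = real q powr ((a - b - 1) / 2) * (sqrt q * real q powr (- a / 2))" .
  have "sqrt q > 0" "real q powr (- a / 2) > 0" using assms by auto
  then show ?thesis unfolding eq spec_rad_def
    using assms by (simp add: divide_simps)
qed

section \<open>The kernel behind Pitman's theorem\<close>

text \<open>Transition probability from \<open>(k, d)\<close> to \<open>(k', d')\<close> for the running maximum \<open>k\<close> of a simple random
  walk with current value \<open>2k - d\<close>. The walk is below its maximum if \<open>k < d\<close>; at its maximum
  (\<open>k = d\<close>) both of its steps increase \<open>d\<close>.\<close>

definition pitman_kernel :: "nat \<Rightarrow> nat \<Rightarrow> nat \<Rightarrow> nat \<Rightarrow> real" where
  "pitman_kernel k d k' d' =
     (if k < d \<and> k' = k \<and> (d' = Suc d \<or> d = Suc d')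
        \<or> k = d \<and> d' = Suc d \<and> (k' = k \<or> k' = Suc k)
      then 1 / 2 else 0)"

text \<open>The probability that the Markov chain with transition probabilities \<open>(m' + 1) / (2 * (m + 1))\<close> from \<open>m\<close> to
  \<open>m' = m \<pm> 1\<close>, started at \<open>0\<close>, follows \<open>d\<close> up to time \<open>n\<close>.\<close>

definition bessel_path_weight :: "nat \<Rightarrow> (nat \<Rightarrow> nat) \<Rightarrow> real" where
  "bessel_path_weight n d =
     (if d 0 = 0 \<and> (\<forall>i<n. d (Suc i) = Suc (d i) \<or> d i = Suc (d (Suc i)))
      then (real (d n) + 1) / 2 ^ n else 0)"

text \<open>Given \<open>k'\<close> and adjacent distances \<open>d\<close>, \<open>d'\<close>, the only possible predecessor of \<open>k'\<close> is
  \<open>min k' d\<close>. This is the combinatorial content of Pitman's theorem.\<close>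

lemma sum_pitman_kernel:
  assumes "k' \<le> d'"
  shows "(\<Sum>k\<le>d. pitman_kernel k d k' d') = (if d' = Suc d \<or> d = Suc d' then 1 / 2 else 0)"
proof -
  have "pitman_kernel k d k' d' =
    (if k = min k' d then (if d' = Suc d \<or> d = Suc d' then 1 / 2 else 0) else 0)" if "k \<le> d" for k
  proof (cases "k' \<le> d")
    case True
    then have "min k' d = k'" by simp
    then show ?thesis using assms that True by (auto simp: pitman_kernel_def)
  next
    case False
    then have "min k' d = d" by simp
    then show ?thesis using assms that False by (auto simp: pitman_kernel_def)
  qed
  then show ?thesis by (simp add: sum.delta cong: sum.cong_simp)
qed

lemma (in prob_space) pitman_recursion:
  fixes K D :: "nat \<Rightarrow> 'a \<Rightarrow> nat"
  assumes [measurable]: "\<And>n. K n \<in> M \<rightarrow>\<^sub>M count_space UNIV" "\<And>n. D n \<in> M \<rightarrow>\<^sub>M count_space UNIV"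
    and KD: "\<And>n w. w \<in> space M \<Longrightarrow> K n w \<le> D n w"
    and step: "\<And>n d k k'. \<P>(w in M. ((\<forall>i\<le>n. D i w = d i) \<and> K n w = k) \<and> D (Suc n) w = d (Suc n) \<and> K (Suc n) w = k')
      = c k (d n) k' (d (Suc n)) * \<P>(w in M. (\<forall>i\<le>n. D i w = d i) \<and> K n w = k)"
  shows "\<P>(w in M. (\<forall>i\<le>Suc n. D i w = d i) \<and> K (Suc n) w = k') =
    (\<Sum>k\<le>d n. c k (d n) k' (d (Suc n)) * \<P>(w in M. (\<forall>i\<le>n. D i w = d i) \<and> K n w = k))"
    and "\<P>(w in M. \<forall>i\<le>n. D i w = d i) = (\<Sum>k\<le>d n. \<P>(w in M. (\<forall>i\<le>n. D i w = d i) \<and> K n w = k))"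
proof -
  let ?A = "\<lambda>k. {w \<in> space M. ((\<forall>i\<le>n. D i w = d i) \<and> K n w = k)
    \<and> D (Suc n) w = d (Suc n) \<and> K (Suc n) w = k'}"
  have "{w \<in> space M. (\<forall>i\<le>Suc n. D i w = d i) \<and> K (Suc n) w = k'} = (\<Union>k\<le>d n. ?A k)"
    using KD[of _ n] by (auto simp: le_Suc_eq) (metis order_refl)
  moreover have "prob (\<Union>k\<le>d n. ?A k) = (\<Sum>k\<le>d n. prob (?A k))"
    by (rule finite_measure_finite_Union) (auto simp: disjoint_family_on_def)
  ultimately show "\<P>(w in M. (\<forall>i\<le>Suc n. D i w = d i) \<and> K (Suc n) w = k') =
    (\<Sum>k\<le>d n. c k (d n) k' (d (Suc n)) * \<P>(w in M. (\<forall>i\<le>n. D i w = d i) \<and> K n w = k))"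
    by (simp only: step)
next
  let ?B = "\<lambda>k. {w \<in> space M. (\<forall>i\<le>n. D i w = d i) \<and> K n w = k}"
  have "{w \<in> space M. \<forall>i\<le>n. D i w = d i} = (\<Union>k\<le>d n. ?B k)"
    using KD[of _ n] by auto (metis order_refl)
  moreover have "prob (\<Union>k\<le>d n. ?B k) = (\<Sum>k\<le>d n. prob (?B k))"
    by (rule finite_measure_finite_Union) (auto simp: disjoint_family_on_def)
  ultimately show "\<P>(w in M. \<forall>i\<le>n. D i w = d i) =
    (\<Sum>k\<le>d n. \<P>(w in M. (\<forall>i\<le>n. D i w = d i) \<and> K n w = k))"
    by (simp only:)
qed

text \<open>The joint probability of the path and of the event that \<open>K\<close> ends in \<open>k\<close> satisfies a finite linear
  recursion, whose limit is solved by \<open>1 / 2 ^ n\<close> for every \<open>k \<le> d n\<close>. A kernel depending on \<open>q\<close> makes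
  the lemma apply to a sequence of chains that have the Pitman kernel only in the limit.\<close>

lemma bessel_path_weight_limit:
  fixes K D :: "nat \<Rightarrow> nat \<Rightarrow> 'm \<Rightarrow> nat"
  assumes M: "\<And>q. 1 \<le> q \<Longrightarrow> prob_space (M q)"
    and meas: "\<And>q n. 1 \<le> q \<Longrightarrow> K q n \<in> M q \<rightarrow>\<^sub>M count_space UNIV"
      "\<And>q n. 1 \<le> q \<Longrightarrow> D q n \<in> M q \<rightarrow>\<^sub>M count_space UNIV"
    and KD: "\<And>q n w. 1 \<le> q \<Longrightarrow> w \<in> space (M q) \<Longrightarrow> K q n w \<le> D q n w"
    and start: "\<And>q. 1 \<le> q \<Longrightarrow> AE w in M q. D q 0 w = 0"
    and step: "\<And>q n d k k'. 1 \<le> q \<Longrightarrow>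
      \<P>(w in M q. ((\<forall>i\<le>n. D q i w = d i) \<and> K q n w = k) \<and> D q (Suc n) w = d (Suc n) \<and> K q (Suc n) w = k')
      = c q k (d n) k' (d (Suc n)) * \<P>(w in M q. (\<forall>i\<le>n. D q i w = d i) \<and> K q n w = k)"
    and c_0: "\<And>q k d k' d'. 1 \<le> q \<Longrightarrow> d' \<noteq> Suc d \<Longrightarrow> d \<noteq> Suc d' \<Longrightarrow> c q k d k' d' = 0"
    and c_lim: "\<And>k d k' d'. k \<le> d \<Longrightarrow> k' \<le> d' \<Longrightarrow> (\<lambda>q. c q k d k' d') \<longlonglongrightarrow> pitman_kernel k d k' d'"
  shows "(\<lambda>q. \<P>(w in M q. \<forall>i\<le>n. D q i w = d i)) \<longlonglongrightarrow> bessel_path_weight n d"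
    and "1 \<le> q \<Longrightarrow> n < d n \<Longrightarrow> \<P>(w in M q. \<forall>i\<le>n. D q i w = d i) = 0"
proof -
  define u where "u q n k = \<P>(w in M q. (\<forall>i\<le>n. D q i w = d i) \<and> K q n w = k)" for q n k
  define nn where "nn n \<longleftrightarrow> d 0 = 0 \<and> (\<forall>i<n. d (Suc i) = Suc (d i) \<or> d i = Suc (d (Suc i)))" for n
  have u_Suc: "u q (Suc n) k' = (\<Sum>k\<le>d n. c q k (d n) k' (d (Suc n)) * u q n k)"
    and path: "\<P>(w in M q. \<forall>i\<le>n. D q i w = d i) = (\<Sum>k\<le>d n. u q n k)" if "1 \<le> q" for q n k'
    unfolding u_def
    using prob_space.pitman_recursion[OF M[OF that], of "K q" "D q" "c q", OF meas[OF that] KD[OF that] step[OF that]]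
    by blast+
  have u_0: "u q 0 k = (if d 0 = 0 \<and> k = 0 then 1 else 0)" if q: "1 \<le> q" for q k
  proof -
    interpret prob_space "M q" by (rule M[OF q])
    note [measurable] = meas[OF q]
    have "AE w in M q. ((\<forall>i\<le>0. D q i w = d i) \<and> K q 0 w = k) = (d 0 = 0 \<and> k = 0)"
      using start[OF q] AE_space by eventually_elim (use KD[OF q, of _ 0] in force)
    then have "u q 0 k = \<P>(w in M q. d 0 = 0 \<and> k = 0)"
      unfolding u_def by (intro prob_eq_AE) auto
    then show ?thesis by (auto simp: prob_space)
  qed
  have lim: "(\<lambda>q. u q n k) \<longlonglongrightarrow> (if nn n then 1 / 2 ^ n else 0)" if "k \<le> d n" for n k
    using that
  proof (induction n arbitrary: k)
    case 0
    have "eventually (\<lambda>q. u q 0 k = (if nn 0 then 1 else 0)) sequentially"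
      using eventually_ge_at_top[of 1] by eventually_elim (use u_0 0 in \<open>auto simp: nn_def\<close>)
    then show ?case unfolding power_0 div_by_1 by (rule tendsto_eventually)
  next
    case (Suc n)
    let ?a = "if nn n then 1 / 2 ^ n else 0 :: real"
    have "eventually (\<lambda>q. (\<Sum>i\<le>d n. c q i (d n) k (d (Suc n)) * u q n i) = u q (Suc n) k) sequentially"
      using eventually_ge_at_top[of 1] by eventually_elim (use u_Suc in auto)
    moreover have "(\<lambda>q. \<Sum>i\<le>d n. c q i (d n) k (d (Suc n)) * u q n i) \<longlonglongrightarrow>
        (\<Sum>i\<le>d n. pitman_kernel i (d n) k (d (Suc n)) * ?a)"
      by (intro tendsto_intros c_lim Suc.IH) (use Suc.prems in auto)
    ultimately have "(\<lambda>q. u q (Suc n) k) \<longlonglongrightarrow> (\<Sum>i\<le>d n. pitman_kernel i (d n) k (d (Suc n)) * ?a)"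
      by (rule Lim_transform_eventually[rotated])
    also have "(\<Sum>i\<le>d n. pitman_kernel i (d n) k (d (Suc n)) * ?a) = (if nn (Suc n) then 1 / 2 ^ Suc n else 0)"
      unfolding sum_distrib_right[symmetric] sum_pitman_kernel[OF Suc.prems]
      by (auto simp: nn_def less_Suc_eq)
    finally show ?case .
  qed
  have "eventually (\<lambda>q. (\<Sum>k\<le>d n. u q n k) = \<P>(w in M q. \<forall>i\<le>n. D q i w = d i)) sequentially"
    using eventually_ge_at_top[of 1] by eventually_elim (use path in auto)
  moreover have "(\<lambda>q. \<Sum>k\<le>d n. u q n k) \<longlonglongrightarrow> (\<Sum>k\<le>d n. if nn n then 1 / 2 ^ n else 0)"
    by (intro tendsto_intros lim) auto
  ultimately have "(\<lambda>q. \<P>(w in M q. \<forall>i\<le>n. D q i w = d i)) \<longlonglongrightarrow> (\<Sum>k\<le>d n. if nn n then 1 / 2 ^ n else 0)"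
    by (rule Lim_transform_eventually[rotated])
  also have "(\<Sum>k\<le>d n. if nn n then 1 / 2 ^ n else 0) = bessel_path_weight n d"
    unfolding bessel_path_weight_def nn_def by (auto simp: add.commute)
  finally show "(\<lambda>q. \<P>(w in M q. \<forall>i\<le>n. D q i w = d i)) \<longlonglongrightarrow> bessel_path_weight n d" .
  show "\<P>(w in M q. \<forall>i\<le>n. D q i w = d i) = 0" if q: "1 \<le> q" and "n < d n"
  proof -
    have "u q n k = 0 \<or> d n \<le> n" for n k
    proof (induction n arbitrary: k)
      case 0 then show ?case using u_0[OF q] by auto
    next
      case (Suc n)
      have "u q (Suc n) k = 0" if "\<not> d (Suc n) \<le> Suc n"
      proof (cases "d n \<le> n")
        case True
        then have "d (Suc n) \<noteq> Suc (d n)" "d n \<noteq> Suc (d (Suc n))" using that by auto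
        then show ?thesis using u_Suc[OF q] c_0[OF q] by simp
      next
        case False
        then show ?thesis using u_Suc[OF q] Suc.IH by simp
      qed
      then show ?case by blast
    qed
    then have "u q n k = 0" for k using \<open>n < d n\<close> by (meson not_le)
    then show ?thesis using path[OF q] by simp
  qed
qed

section \<open>Twice the maximum minus the walk\<close>

lemma MAX_atMost_Suc:
  fixes x :: "nat \<Rightarrow> int"
  shows "(MAX k\<in>{0..Suc n}. x k) = max (MAX k\<in>{0..n}. x k) (x (Suc n))"
  by (simp add: atLeastAtMostSuc_conv max.commute)

lemma measurable_running_MAX:
  fixes \<Sigma> :: "nat \<Rightarrow> 'a \<Rightarrow> int"
  assumes [measurable]: "\<And>n. \<Sigma> n \<in> M \<rightarrow>\<^sub>M count_space UNIV"
  shows "(\<lambda>w. MAX k\<in>{0..n}. \<Sigma> k w) \<in> M \<rightarrow>\<^sub>M count_space UNIV"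
proof (induction n)
  case (Suc n)
  note [measurable] = this
  show ?case unfolding MAX_atMost_Suc by measurable
qed simp

text \<open>Here \<open>k\<close> is the maximum of the walk so far and \<open>s\<close> its current value.\<close>

lemma pitman_kernel_row:
  fixes s :: int
  assumes "k \<le> d" and s: "s = 2 * int k - int d"
  shows "(\<Sum>y | int_srw_trans s y \<noteq> 0 \<and> nat (2 * max (int k) y - y) = d' \<and> nat (max (int k) y) = k'. int_srw_trans s y)
    = pitman_kernel k d k' d'"
proof -
  let ?R = "\<lambda>y. nat (2 * max (int k) y - y) = d' \<and> nat (max (int k) y) = k'"
  have "{y. int_srw_trans s y \<noteq> 0 \<and> ?R y} = {y \<in> {s - 1, s + 1}. ?R y}"
    unfolding int_srw_trans_def by auto
  then have "(\<Sum>y | int_srw_trans s y \<noteq> 0 \<and> ?R y. int_srw_trans s y) =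
    (\<Sum>y\<in>{s - 1, s + 1}. if ?R y then int_srw_trans s y else 0)"
    by (simp only: sum.inter_filter finite.intros)
  also have "\<dots> = (if ?R (s - 1) then 1 / 2 else 0) + (if ?R (s + 1) then 1 / 2 else 0)"
    by (simp add: int_srw_trans_def)
  also have "?R (s - 1) \<longleftrightarrow> k' = k \<and> d' = Suc d"
    using assms by auto
  also have "?R (s + 1) \<longleftrightarrow> (if k < d then k' = k \<and> d = Suc d' else k' = Suc k \<and> d' = Suc d)"
    using assms by auto
  finally show ?thesis using assms(1) by (auto simp: pitman_kernel_def)
qed

text \<open>Pitman's theorem for the simple random walk. Together with the running maximum, the process
  \<open>2 max \<Sigma> - \<Sigma>\<close> is a Markov chain with transition kernel \<open>pitman_kernel\<close>, since the pair determines the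
  current value of \<open>\<Sigma>\<close>.\<close>

lemma pitman_paths:
  assumes mc: "markov_chain N UNIV 0 int_srw_trans \<Sigma>"
  defines "D \<equiv> \<lambda>n w. nat (2 * (MAX k\<in>{0..n}. \<Sigma> k w) - \<Sigma> n w)"
  shows "\<P>(w in N. \<forall>i\<le>n. D i w = d i) = bessel_path_weight n d"
proof -
  interpret prob_space N using mc unfolding markov_chain_def by blast
  define Mx where "Mx n x = (MAX k\<in>{0..n}. x k)" for n and x :: "nat \<Rightarrow> int"
  define K where "K n w = nat (Mx n (\<lambda>k. \<Sigma> k w))" for n w
  have D: "D n w = nat (2 * Mx n (\<lambda>k. \<Sigma> k w) - \<Sigma> n w)" for n w
    unfolding D_def Mx_def ..
  have Mx_Suc: "Mx (Suc n) x = max (Mx n x) (x (Suc n))" for n x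
    unfolding Mx_def by (rule MAX_atMost_Suc)
  have Mx_ge: "x i \<le> Mx n x" if "i \<le> n" for i n x
    unfolding Mx_def using that by (intro Max_ge) auto
  have Mx_cong: "Mx i (restrict x {..n}) = Mx i x" if "i \<le> n" for i n x
    unfolding Mx_def using that by (intro arg_cong[where f = Max] image_cong) auto
  have \<Sigma>_meas [measurable]: "\<Sigma> n \<in> N \<rightarrow>\<^sub>M count_space UNIV" for n
    using mc unfolding markov_chain_def by blast
  have [measurable]: "(\<lambda>w. Mx n (\<lambda>k. \<Sigma> k w)) \<in> N \<rightarrow>\<^sub>M count_space UNIV" for n
    unfolding Mx_def by (rule measurable_running_MAX) (rule \<Sigma>_meas)
  have [measurable]: "K n \<in> N \<rightarrow>\<^sub>M count_space UNIV" "D n \<in> N \<rightarrow>\<^sub>M count_space UNIV" for n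
    unfolding K_def[abs_def] D[abs_def] by measurable
  have start: "AE w in N. \<Sigma> 0 w = 0" using mc unfolding markov_chain_def by blast
  have KD: "K n w \<le> D n w" for n w
    unfolding K_def D using Mx_ge[of n n "\<lambda>k. \<Sigma> k w"] by simp
  have step: "\<P>(w in N. ((\<forall>i\<le>n. D i w = d i) \<and> K n w = k) \<and> D (Suc n) w = d (Suc n) \<and> K (Suc n) w = k')
      = pitman_kernel k (d n) k' (d (Suc n)) * \<P>(w in N. (\<forall>i\<le>n. D i w = d i) \<and> K n w = k)"
    for n k k' and d :: "nat \<Rightarrow> nat"
  proof -
    \<comment> \<open>The condition \<open>x 0 = 0\<close> holds almost surely. It is part of the event since it makes the running maximum
      nonnegative, so that \<open>nat\<close> loses no information.\<close>
    let ?Q = "\<lambda>x. x 0 = 0 \<and> (\<forall>i\<le>n. nat (2 * Mx i x - x i) = d i) \<and> nat (Mx n x) = k"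
    let ?R = "\<lambda>x y. nat (2 * max (Mx n x) y - y) = d (Suc n) \<and> nat (max (Mx n x) y) = k'"
    let ?x = "\<lambda>w. restrict (\<lambda>k. \<Sigma> k w) {..n}"
    have "\<P>(w in N. ?Q (?x w) \<and> ?R (?x w) (\<Sigma> (Suc n) w)) =
      pitman_kernel k (d n) k' (d (Suc n)) * \<P>(w in N. ?Q (?x w))"
    proof (rule markov_chain_one_step[OF mc])
      show "finite {y \<in> UNIV. int_srw_trans x y \<noteq> 0}" for x
        by (rule finite_subset[of _ "{x - 1, x + 1}"]) (auto simp: int_srw_trans_def)
      show "0 \<le> int_srw_trans x y" for x y unfolding int_srw_trans_def by simp
      fix x assume "?Q x"
      then have "Mx n x = int k" "x n = 2 * int k - int (d n)" "k \<le> d n"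
        using Mx_ge[of 0 n x] Mx_ge[of n n x] by auto
      then show "(\<Sum>y | y \<in> UNIV \<and> int_srw_trans (x n) y \<noteq> 0 \<and> ?R x y. int_srw_trans (x n) y)
          = pitman_kernel k (d n) k' (d (Suc n))"
        using pitman_kernel_row[of k "d n" "x n" "d (Suc n)" k'] by simp
    qed auto
    moreover have "\<P>(w in N. ?Q (?x w) \<and> ?R (?x w) (\<Sigma> (Suc n) w)) =
      \<P>(w in N. ((\<forall>i\<le>n. D i w = d i) \<and> K n w = k) \<and> D (Suc n) w = d (Suc n) \<and> K (Suc n) w = k')"
    proof (rule prob_eq_AE)
      show "AE w in N. (?Q (?x w) \<and> ?R (?x w) (\<Sigma> (Suc n) w)) = (((\<forall>i\<le>n. D i w = d i) \<and> K n w = k)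
          \<and> D (Suc n) w = d (Suc n) \<and> K (Suc n) w = k')"
        using start by eventually_elim (simp add: D K_def Mx_cong Mx_Suc)
    qed (simp_all add: Mx_cong cong: conj_cong)
    moreover have "\<P>(w in N. ?Q (?x w)) = \<P>(w in N. (\<forall>i\<le>n. D i w = d i) \<and> K n w = k)"
    proof (rule prob_eq_AE)
      show "AE w in N. ?Q (?x w) = ((\<forall>i\<le>n. D i w = d i) \<and> K n w = k)"
        using start by eventually_elim (simp add: D K_def Mx_cong)
    qed (simp_all add: Mx_cong cong: conj_cong)
    ultimately show ?thesis by simp
  qed
  have start': "AE w in N. D 0 w = 0"
    using start by eventually_elim (simp add: D Mx_def)
  \<comment> \<open>The kernel is already the limiting one, so the limit along a constant sequence gives equality.\<close>
  have "(\<lambda>q::nat. \<P>(w in N. \<forall>i\<le>n. D i w = d i)) \<longlonglongrightarrow> bessel_path_weight n d"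
  proof (rule bessel_path_weight_limit(1)[where M = "\<lambda>_. N" and K = "\<lambda>_. K" and D = "\<lambda>_. D" and c = "\<lambda>_. pitman_kernel"])
    show "pitman_kernel k d k' d' = 0" if "d' \<noteq> Suc d" "d \<noteq> Suc d'" for k d k' d'
      using that unfolding pitman_kernel_def by auto
  qed (use step KD start' prob_space_axioms in auto)
  then show ?thesis using LIMSEQ_unique tendsto_const by blast
qed

section \<open>The ground state process of the spherical function\<close>

text \<open>The factor \<open>d n + 1\<close> cancels: this is the telescoping product of the Bessel transition probabilities.\<close>

lemma bessel_path_weight_Suc:
  "bessel_path_weight (Suc n) d =
    (if d (Suc n) = Suc (d n) \<or> d n = Suc (d (Suc n)) then (real (d (Suc n)) + 1) / (2 * (real (d n) + 1)) else 0)
      * bessel_path_weight n d"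
proof -
  let ?adj = "d (Suc n) = Suc (d n) \<or> d n = Suc (d (Suc n))"
  have eq: "a / (2 * b) * (b / 2 ^ n) = a / 2 ^ Suc n" if "b \<noteq> 0" for a b :: real
    using that by simp
  have nz: "real (d n) + 1 \<noteq> 0" by (simp add: add_eq_0_iff)
  have nn: "(d 0 = 0 \<and> (\<forall>i<Suc n. d (Suc i) = Suc (d i) \<or> d i = Suc (d (Suc i)))) \<longleftrightarrow>
      (d 0 = 0 \<and> (\<forall>i<n. d (Suc i) = Suc (d i) \<or> d i = Suc (d (Suc i)))) \<and> ?adj"
    by (auto simp: less_Suc_eq)
  show ?thesis unfolding bessel_path_weight_def nn
    by (simp only: eq[OF nz] mult_zero_left mult_zero_right split: if_split) blast
qed

text \<open>The polynomial factor of \<open>\<phi>\<^sub>0\<close> at distance \<open>m\<close> from the origin.\<close>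

definition radial_factor :: "nat \<Rightarrow> nat \<Rightarrow> real" where
  "radial_factor q m = 1 + real m * ((real q - 1) / (real q + 1))"

text \<open>At the origin all \<open>q + 1\<close> neighbours lie at distance one, so the step to \<open>1\<close> is certain. Elsewhere the
  number \<open>q\<close> of farther neighbours cancels the factor \<open>1 / q\<close> in the probability of each of them.\<close>

definition radial_kernel :: "nat \<Rightarrow> nat \<Rightarrow> nat \<Rightarrow> real" where
  "radial_kernel q m m' =
     (if m' = Suc m then (if m = 0 then 1 else radial_factor q m' / (2 * radial_factor q m))
      else if m = Suc m' then radial_factor q m' / (2 * radial_factor q m) else 0)"

lemma radial_factor_pos: "1 \<le> q \<Longrightarrow> 0 < radial_factor q m"
  unfolding radial_factor_def by (intro add_pos_nonneg) auto

lemma ground_trans_phi_zero: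
  assumes "1 \<le> q" "E x y"
  shows "ground_trans q E (phi_zero q E r) x y =
    radial_factor q (graph_dist E r y) / (2 * radial_factor q (graph_dist E r x))
      * real q powr ((real (graph_dist E r x) - real (graph_dist E r y) - 1) / 2)"
  unfolding ground_trans_def phi_zero_def srw_trans_def radial_factor_def[symmetric]
  using assms(2) by (simp only: powr_half_step[OF assms(1)] if_True)

lemma radial_kernel_row:
  assumes q: "1 \<le> q" and T: "homogeneous_tree q V E" and r: "r \<in> V" and x: "x \<in> V"
  shows "(\<Sum>y | E x y \<and> graph_dist E r y = m'. ground_trans q E (phi_zero q E r) x y) =
    radial_kernel q (graph_dist E r x) m'"
proof -
  interpret tree V E by (rule homogeneous_tree_imp_tree[OF T])
  define m where "m = graph_dist E r x"
  let ?N = "{y. E x y}" and ?S = "{y. E x y \<and> graph_dist E r y = m'}"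
  note deg = homogeneous_tree_degree[OF T x]
  have "(\<Sum>y\<in>?S. ground_trans q E (phi_zero q E r) x y) =
    (\<Sum>y\<in>?S. radial_factor q m' / (2 * radial_factor q m) * real q powr ((real m - real m' - 1) / 2))"
    by (rule sum.cong) (use ground_trans_phi_zero[OF q] m_def in auto)
  also have "\<dots> = real (card ?S) * (radial_factor q m' / (2 * radial_factor q m) * real q powr ((real m - real m' - 1) / 2))"
    by simp
  also have "\<dots> = radial_kernel q m m'"
  proof (cases "x = r")
    case True
    then have "m = 0" unfolding m_def by simp
    have "graph_dist E r y = 1" if "E x y" for y using graph_dist_edge that True by blast
    then have "?S = (if m' = 1 then ?N else {})" by auto
    then show ?thesis using deg(1) \<open>m = 0\<close> q
      by (auto simp: radial_kernel_def radial_factor_def powr_minus_divide field_simps)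
  next
    case False
    obtain p where p: "E x p" "Suc (graph_dist E r p) = graph_dist E r x"
      "\<And>y. E x y \<Longrightarrow> y \<noteq> p \<Longrightarrow> graph_dist E r y = Suc (graph_dist E r x)"
      by (rule unique_closer_neighbour[OF r x False]) blast
    have S: "?S = (if m' = Suc m then ?N - {p} else if m = Suc m' then {p} else {})"
      using p unfolding m_def by force
    have "card (?N - {p}) = q" using deg p(1) by simp
    moreover have "m \<noteq> 0" using p(2) unfolding m_def by simp
    ultimately show ?thesis using q unfolding S
      by (auto simp: radial_kernel_def powr_minus_divide)
  qed
  finally show ?thesis unfolding m_def .
qed

lemma radial_factor_lim: "(\<lambda>q. radial_factor q m) \<longlonglongrightarrow> real m + 1"
proof -
  have "(\<lambda>q. 1 + real m * (1 - 2 * inverse (real (Suc q)))) \<longlonglongrightarrow> 1 + real m * (1 - 2 * 0)"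
    by (intro tendsto_intros LIMSEQ_inverse_real_of_nat)
  moreover have "(\<lambda>q. 1 + real m * (1 - 2 * inverse (real (Suc q)))) = (\<lambda>q. radial_factor q m)"
    by (auto simp: radial_factor_def field_simps)
  ultimately show ?thesis by (simp add: add.commute)
qed

lemma radial_kernel_lim:
  "(\<lambda>q. radial_kernel q m m') \<longlonglongrightarrow>
    (if m' = Suc m \<or> m = Suc m' then (real m' + 1) / (2 * (real m + 1)) else 0)"
proof -
  have l: "(\<lambda>q. radial_factor q m' / (2 * radial_factor q m)) \<longlonglongrightarrow> (real m' + 1) / (2 * (real m + 1))"
    by (intro tendsto_intros radial_factor_lim) (simp add: add_eq_0_iff)
  show ?thesis
  proof (cases "m' = Suc m \<and> m = 0")
    case True
    then show ?thesis by (simp add: radial_kernel_def)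
  next
    case False
    then show ?thesis using l by (auto simp: radial_kernel_def)
  qed
qed

text \<open>By \<open>radial_kernel_row\<close>, the probability of stepping to a given distance depends on the current distance
  only, so the path probabilities are products of values of \<open>radial_kernel\<close>.\<close>

lemma phi_zero_chain_paths:
  assumes T: "\<And>q. 1 \<le> q \<Longrightarrow> homogeneous_tree q (V q) (E q)"
    and r: "\<And>q. 1 \<le> q \<Longrightarrow> r q \<in> V q"
    and mc: "\<And>q. 1 \<le> q \<Longrightarrow> markov_chain (M q) (V q) (r q)
        (ground_trans q (E q) (phi_zero q (E q) (r q))) (X q)"
  defines "P \<equiv> \<lambda>q n d. \<P>(w in M q. \<forall>i\<le>n. graph_dist (E q) (r q) (X q i w) = d i)"
  shows "(\<lambda>q. P q n d) \<longlonglongrightarrow> bessel_path_weight n d"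
    and "1 \<le> q \<Longrightarrow> n < d n \<Longrightarrow> P q n d = 0"
proof -
  have P_Suc: "P q (Suc n) d = radial_kernel q (d n) (d (Suc n)) * P q n d" if q: "1 \<le> q" for q n
  proof -
    have pos: "0 < phi_zero q (E q) (r q) x" for x
      using radial_factor_pos[OF q] q unfolding phi_zero_def radial_factor_def[symmetric] by simp
    have "\<P>(w in M q. (\<forall>i\<le>n. graph_dist (E q) (r q) (restrict (\<lambda>k. X q k w) {..n} i) = d i) \<and>
        graph_dist (E q) (r q) (X q (Suc n) w) = d (Suc n)) = radial_kernel q (d n) (d (Suc n)) *
      \<P>(w in M q. (\<forall>i\<le>n. graph_dist (E q) (r q) (restrict (\<lambda>k. X q k w) {..n} i) = d i))"
    proof (rule ground_chain_one_step[OF q T[OF q] pos mc[OF q]])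
      fix x assume x: "x \<in> {..n} \<rightarrow>\<^sub>E V q" "\<forall>i\<le>n. graph_dist (E q) (r q) (x i) = d i"
      then have "x n \<in> V q" by auto
      then show "(\<Sum>y | E q (x n) y \<and> graph_dist (E q) (r q) y = d (Suc n).
          ground_trans q (E q) (phi_zero q (E q) (r q)) (x n) y) = radial_kernel q (d n) (d (Suc n))"
        using radial_kernel_row[OF q T[OF q] r[OF q]] x(2) by simp
    qed
    moreover have "(\<forall>i\<le>Suc n. A i) \<longleftrightarrow> (\<forall>i\<le>n. A i) \<and> A (Suc n)" for A
      by (auto simp: le_Suc_eq)
    ultimately show ?thesis unfolding P_def by simp
  qed
  have P_0: "P q 0 d = (if d 0 = 0 then 1 else 0)" if q: "1 \<le> q" for q
  proof -
    interpret prob_space "M q" using mc[OF q] unfolding markov_chain_def by blast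
    note [measurable] = measurable_markov_chain_pred[OF mc[OF q]]
    have "AE w in M q. (\<forall>i\<le>0. graph_dist (E q) (r q) (X q i w) = d i) = (d 0 = 0)"
      using ground_chain_radius_start[OF T[OF q] mc[OF q]] by eventually_elim auto
    then have "P q 0 d = \<P>(w in M q. d 0 = 0)"
      unfolding P_def by (intro prob_eq_AE) auto
    then show ?thesis by (auto simp: prob_space)
  qed
  show "(\<lambda>q. P q n d) \<longlonglongrightarrow> bessel_path_weight n d"
  proof (induction n)
    case 0
    have "eventually (\<lambda>q. P q 0 d = bessel_path_weight 0 d) sequentially"
      using eventually_ge_at_top[of 1] by eventually_elim (use P_0 in \<open>auto simp: bessel_path_weight_def\<close>)
    then show ?case by (rule tendsto_eventually)
  next
    case (Suc n)
    have "eventually (\<lambda>q. radial_kernel q (d n) (d (Suc n)) * P q n d = P q (Suc n) d) sequentially"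
      using eventually_ge_at_top[of 1] by eventually_elim (use P_Suc in auto)
    then show ?case unfolding bessel_path_weight_Suc
      by (rule Lim_transform_eventually[rotated]) (intro tendsto_mult radial_kernel_lim Suc.IH)
  qed
  show "P q n d = 0" if q: "1 \<le> q" and "n < d n"
  proof -
    have "P q n d = 0 \<or> d n \<le> n"
    proof (induction n)
      case 0 then show ?case using P_0[OF q] by auto
    next
      case (Suc n)
      then show ?case using P_Suc[OF q, of n] by (auto simp: radial_kernel_def)
    qed
    then show ?thesis using \<open>n < d n\<close> by simp
  qed
qed

section \<open>The ground state process of a ray\<close>

text \<open>Transition probability from (index of the projection, distance to the origin) \<open>= (k, d)\<close> to \<open>(k', d')\<close>. Off
  the ray, that is for \<open>k < d\<close>, it agrees with \<open>pitman_kernel\<close>. At \<open>\<omega> k\<close> the cases are a step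
  forward along the ray, a step off the ray, and a step back along the ray, the latter only for \<open>k > 0\<close>.\<close>

definition ray_kernel :: "nat \<Rightarrow> nat \<Rightarrow> nat \<Rightarrow> nat \<Rightarrow> nat \<Rightarrow> real" where
  "ray_kernel q k d k' d' =
     (if k < d then (if k' = k \<and> (d' = Suc d \<or> d = Suc d') then 1 / 2 else 0)
      else if d' = Suc d \<and> k' = Suc k then 1 / 2
      else if d' = Suc d \<and> k' = k then (if k = 0 then 1 / 2 else 1 / 2 - 1 / (2 * real q))
      else if d = Suc d' \<and> k = Suc k' then 1 / (2 * real q) else 0)"

lemma ray_kernel_lim:
  assumes "k \<le> d" "k' \<le> d'"
  shows "(\<lambda>q. ray_kernel q k d k' d') \<longlonglongrightarrow> pitman_kernel k d k' d'"
proof -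
  have 1: "(\<lambda>q. 1 / (2 * real q)) \<longlonglongrightarrow> 0"
    using tendsto_mult[OF tendsto_const[of "1/2"] lim_inverse_n'] by simp
  have 2: "(\<lambda>q. 1 / 2 - 1 / (2 * real q)) \<longlonglongrightarrow> 1 / 2"
    using tendsto_diff[OF tendsto_const[of "1/2"] 1] by simp
  consider "k < d" | "k = d" "d' = Suc d" "k' = Suc k" | "k = d" "d' = Suc d" "k' = k"
    | "k = d" "d = Suc d'" "k = Suc k'"
    | "k = d" "\<not> (d' = Suc d \<and> k' = Suc k)" "\<not> (d' = Suc d \<and> k' = k)" "\<not> (d = Suc d' \<and> k = Suc k')"
    using assms by linarith
  then show ?thesis
  proof cases
    case 3
    then show ?thesis using 2 by (cases "k = 0") (auto simp: ray_kernel_def pitman_kernel_def)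
  next
    case 5
    then have "ray_kernel q k d k' d' = 0" "pitman_kernel k d k' d' = 0" for q
      by (auto simp: ray_kernel_def pitman_kernel_def)
    then show ?thesis by simp
  qed (use 1 2 in \<open>auto simp: ray_kernel_def pitman_kernel_def\<close>)
qed

lemma ground_trans_phi_ray:
  assumes "1 \<le> q" "E x y"
  shows "ground_trans q E (phi_ray q E r \<omega>) x y =
    1 / 2 * real q powr ((real_of_int (ray_height E r \<omega> x) - real_of_int (ray_height E r \<omega> y) - 1) / 2)"
  unfolding ground_trans_def phi_ray_def srw_trans_def
  using assms(2) powr_half_step[OF assms(1), of 1 _ 1] by simp

text \<open>The transition probability to a neighbour depends only on the change of height, so the rows follow by
  counting the neighbours with given coordinates.\<close>

lemma ray_kernel_row:
  assumes q: "1 \<le> q" and T: "homogeneous_tree q V E" and ray: "geodesic_ray V E r \<omega>" and x: "x \<in> V"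
  defines "K \<equiv> \<lambda>y. graph_dist E r (ray_proj E \<omega> y)"
  shows "K x \<le> graph_dist E r x"
    and "(\<Sum>y | E x y \<and> graph_dist E r y = d' \<and> K y = k'. ground_trans q E (phi_ray q E r \<omega>) x y) =
      ray_kernel q (K x) (graph_dist E r x) k' d'"
proof -
  interpret tree V E by (rule homogeneous_tree_imp_tree[OF T])
  interpret tree_ray V E r \<omega> by unfold_locales (rule ray)
  let ?g = "ground_trans q E (phi_ray q E r \<omega>) x"
  let ?N = "{y. E x y}" and ?S = "{y. E x y \<and> graph_dist E r y = d' \<and> K y = k'}"
  note deg = homogeneous_tree_degree[OF T x]
  obtain k j where c: "ray_coords E \<omega> x k j" using ray_coords_exists[OF x] .
  have Kx: "K x = k" "graph_dist E r x = k + j" using ray_coords_dist[OF c] unfolding K_def by auto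
  then show "K x \<le> graph_dist E r x" by simp
  have coord: "graph_dist E r y = k1 + j1 \<and> K y = k1 \<and> 
      ?g y = 1 / 2 * real q powr ((real j - real k - (real j1 - real k1) - 1) / 2)"
    if "E x y" "ray_coords E \<omega> y k1 j1" for y k1 j1
    using ray_coords_dist[OF that(2)] ray_coords_dist[OF c] ground_trans_phi_ray[OF q, where E = E and r = r and \<omega> = \<omega>, OF that(1)]
    unfolding K_def by simp
  have "sum ?g ?S = ray_kernel q k (k + j) k' d'"
  proof (cases j)
    case (Suc i)
    obtain p where p: "E x p" "ray_coords E \<omega> p k i"
      "\<And>y. E x y \<Longrightarrow> y \<noteq> p \<Longrightarrow> ray_coords E \<omega> y k (Suc (Suc i))"
      using ray_coords_step_off[OF x c[unfolded Suc]] by blast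
    note cp = coord[OF p(1,2)] and co = coord[OF _ p(3)]
    have S: "?S = (if k' = k \<and> d' = k + Suc (Suc i) then ?N - {p} else if k' = k \<and> d' = k + i then {p} else {})"
    proof -
      have "y \<in> ?S \<longleftrightarrow> E x y \<and> k' = k \<and> d' = (if y = p then k + i else k + Suc (Suc i))" for y
      proof (cases "y = p")
        case True
        then show ?thesis using cp p(1) by auto
      next
        case False
        then have "E x y \<Longrightarrow> graph_dist E r y = k + Suc (Suc i) \<and> K y = k" using co[of y] by blast
        then show ?thesis using False by auto
      qed
      then show ?thesis using p(1) by (intro set_eqI) simp
    qed
    have gp: "?g p = 1 / 2" using cp Suc q by simp
    have go: "?g y = 1 / (2 * real q)" if "y \<in> ?N - {p}" for y
      using co[of y] that Suc q by (simp add: powr_minus_divide)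
    have "card (?N - {p}) = q" using deg p(1) by simp
    then have "sum ?g (?N - {p}) = 1 / 2" using go q by simp
    then show ?thesis unfolding S using gp Suc by (auto simp: ray_kernel_def)
  next
    case 0
    have xk: "x = \<omega> k" using c 0 ray_coords_0_iff[OF x] by simp
    have E1: "E x (\<omega> (Suc k))" using ray_edge xk by simp
    note c1 = coord[OF E1 ray_coords_ray]
    have g1: "?g (\<omega> (Suc k)) = 1 / 2" using c1 0 q by simp
    show ?thesis
    proof (cases k)
      case k0: 0
      have co: "graph_dist E r y = k + 1 \<and> K y = k \<and> ?g y = 1 / (2 * real q)"
        if "E x y" "y \<noteq> \<omega> (Suc k)" for y
        using coord[OF that(1) ray_coords_step_on[of k y]] that xk k0 0 q by (simp add: powr_minus_divide)
      have S: "?S = (if d' = Suc k \<and> k' = Suc k then {\<omega> (Suc k)} else if d' = Suc k \<and> k' = k then ?N - {\<omega> (Suc k)} else {})"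
      proof -
        have "y \<in> ?S \<longleftrightarrow> E x y \<and> d' = Suc k \<and> k' = (if y = \<omega> (Suc k) then Suc k else k)" for y
        proof (cases "y = \<omega> (Suc k)")
          case True
          then show ?thesis using c1 E1 by auto
        next
          case False
          then have "E x y \<Longrightarrow> graph_dist E r y = Suc k \<and> K y = k" using co[of y] by simp
          then show ?thesis using False by auto
        qed
        then show ?thesis using E1 by (intro set_eqI) simp
      qed
      have "card (?N - {\<omega> (Suc k)}) = q" using deg E1 by simp
      then have "sum ?g (?N - {\<omega> (Suc k)}) = 1 / 2" using co q by simp
      then show ?thesis unfolding S using g1 0 k0 by (auto simp: ray_kernel_def)
    next
      case (Suc l)
      have E2: "E x (\<omega> l)" using ray_edge[of l] edgeD(4) xk Suc by simp
      note c2 = coord[OF E2 ray_coords_ray]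
      have g2: "?g (\<omega> l) = 1 / (2 * real q)" using c2 0 Suc q by (simp add: powr_minus_divide)
      have co: "graph_dist E r y = k + 1 \<and> K y = k \<and> ?g y = 1 / (2 * real q)"
        if "E x y" "y \<noteq> \<omega> (Suc k)" "y \<noteq> \<omega> l" for y
        using coord[OF that(1) ray_coords_step_on[of k y]] that xk Suc 0 q by (simp add: powr_minus_divide)
      have ne: "\<omega> l \<noteq> \<omega> (Suc k)" using ray_inj Suc by (auto dest: injD)
      have S: "?S = (if d' = Suc k \<and> k' = Suc k then {\<omega> (Suc k)}
          else if d' = Suc k \<and> k' = k then ?N - {\<omega> (Suc k), \<omega> l}
          else if d' = l \<and> k' = l then {\<omega> l} else {})"
      proof -
        have "y \<in> ?S \<longleftrightarrow> E x y \<and> d' = (if y = \<omega> l then l else Suc k)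
            \<and> k' = (if y = \<omega> (Suc k) then Suc k else if y = \<omega> l then l else k)" for y
        proof -
          consider "y = \<omega> (Suc k)" | "y = \<omega> l" | "y \<noteq> \<omega> (Suc k)" "y \<noteq> \<omega> l" by blast
          then show ?thesis
          proof cases
            case 1
            then show ?thesis using c1 E1 ne by auto
          next
            case 2
            then show ?thesis using c2 E2 ne by auto
          next
            case 3
            then have "E x y \<Longrightarrow> graph_dist E r y = Suc k \<and> K y = k" using co[of y] by simp
            then show ?thesis using 3 by auto
          qed
        qed
        then show ?thesis using E1 E2 ne Suc by (intro set_eqI) simp
      qed
      have card_eq: "card (?N - {\<omega> (Suc k), \<omega> l}) = q - 1"
        using deg E1 E2 ne by (simp add: card_Diff_subset)
      have "sum ?g (?N - {\<omega> (Suc k), \<omega> l}) = 1 / 2 - 1 / (2 * real q)"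
      proof -
        have "sum ?g (?N - {\<omega> (Suc k), \<omega> l}) = (\<Sum>y\<in>?N - {\<omega> (Suc k), \<omega> l}. 1 / (2 * real q))"
          by (rule sum.cong) (use co in auto)
        also have "\<dots> = real (q - 1) * (1 / (2 * real q))" using card_eq by simp
        also have "\<dots> = 1 / 2 - 1 / (2 * real q)" using q by (simp add: of_nat_diff field_simps)
        finally show ?thesis .
      qed
      then show ?thesis unfolding S using g1 g2 0 Suc by (auto simp: ray_kernel_def)
    qed
  qed
  then show "sum ?g ?S = ray_kernel q (K x) (graph_dist E r x) k' d'" unfolding Kx .
qed

text \<open>On the ray and off it the distance moves with different probabilities, so the index of the projection is carried
  along: the pair is a Markov chain by \<open>ray_kernel_row\<close>.\<close>

lemma phi_ray_chain_paths:
  assumes T: "\<And>q. 1 \<le> q \<Longrightarrow> homogeneous_tree q (V q) (E q)"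
    and ray: "\<And>q. 1 \<le> q \<Longrightarrow> geodesic_ray (V q) (E q) (r q) (\<omega> q)"
    and mc: "\<And>q. 1 \<le> q \<Longrightarrow> markov_chain (M q) (V q) (r q)
        (ground_trans q (E q) (phi_ray q (E q) (r q) (\<omega> q))) (X q)"
  defines "P \<equiv> \<lambda>q n d. \<P>(w in M q. \<forall>i\<le>n. graph_dist (E q) (r q) (X q i w) = d i)"
  shows "(\<lambda>q. P q n d) \<longlonglongrightarrow> bessel_path_weight n d"
    and "1 \<le> q \<Longrightarrow> n < d n \<Longrightarrow> P q n d = 0"
proof -
  define K where "K q n w = graph_dist (E q) (r q) (ray_proj (E q) (\<omega> q) (X q n w))" for q n w
  define D where "D q n w = graph_dist (E q) (r q) (X q n w)" for q n w
  have step: "\<P>(w in M q. ((\<forall>i\<le>n. D q i w = d i) \<and> K q n w = k) \<and> D q (Suc n) w = d (Suc n) \<and> K q (Suc n) w = k')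
      = ray_kernel q k (d n) k' (d (Suc n)) * \<P>(w in M q. (\<forall>i\<le>n. D q i w = d i) \<and> K q n w = k)"
    if q: "1 \<le> q" for q n k k' and d :: "nat \<Rightarrow> nat"
  proof -
    let ?Q = "\<lambda>x. (\<forall>i\<le>n. graph_dist (E q) (r q) (x i) = d i) \<and> graph_dist (E q) (r q) (ray_proj (E q) (\<omega> q) (x n)) = k"
    let ?R = "\<lambda>y. graph_dist (E q) (r q) y = d (Suc n) \<and> graph_dist (E q) (r q) (ray_proj (E q) (\<omega> q) y) = k'"
    have "\<P>(w in M q. ?Q (restrict (\<lambda>k. X q k w) {..n}) \<and> ?R (X q (Suc n) w)) =
      ray_kernel q k (d n) k' (d (Suc n)) * \<P>(w in M q. ?Q (restrict (\<lambda>k. X q k w) {..n}))"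
    proof (rule ground_chain_one_step[OF q T[OF q] _ mc[OF q]])
      show "0 < phi_ray q (E q) (r q) (\<omega> q) x" for x using q unfolding phi_ray_def by simp
      fix x assume x: "x \<in> {..n} \<rightarrow>\<^sub>E V q" "?Q x"
      then have "x n \<in> V q" by auto
      then show "(\<Sum>y | E q (x n) y \<and> ?R y. ground_trans q (E q) (phi_ray q (E q) (r q) (\<omega> q)) (x n) y)
          = ray_kernel q k (d n) k' (d (Suc n))"
        using ray_kernel_row(2)[OF q T[OF q] ray[OF q]] x(2) by simp
    qed
    then show ?thesis unfolding D_def K_def by simp
  qed
  have KD: "K q n w \<le> D q n w" if q: "1 \<le> q" and w: "w \<in> space (M q)" for q n w
  proof -
    have "X q n w \<in> V q" using mc[OF q] w unfolding markov_chain_def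
      by (auto dest!: spec[of _ n] measurable_space)
    then show ?thesis unfolding K_def D_def by (rule ray_kernel_row(1)[OF q T[OF q] ray[OF q]])
  qed
  have M: "prob_space (M q)" if "1 \<le> q" for q using mc[OF that] unfolding markov_chain_def by blast
  have start: "AE w in M q. D q 0 w = 0" if "1 \<le> q" for q
    unfolding D_def by (rule ground_chain_radius_start[OF T[OF that] mc[OF that]])
  have meas: "K q n \<in> M q \<rightarrow>\<^sub>M count_space UNIV" "D q n \<in> M q \<rightarrow>\<^sub>M count_space UNIV" if "1 \<le> q" for q n
    unfolding K_def[abs_def] D_def[abs_def] by (rule measurable_markov_chain_fun[OF mc[OF that]])+
  have zero: "ray_kernel q k d k' d' = 0" if "d' \<noteq> Suc d" "d \<noteq> Suc d'" for q k d k' d'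
    using that unfolding ray_kernel_def by auto
  note lim = bessel_path_weight_limit[of M K D ray_kernel, OF M meas KD start step zero ray_kernel_lim]
  show "(\<lambda>q. P q n d) \<longlonglongrightarrow> bessel_path_weight n d"
    unfolding P_def D_def[symmetric] by (rule lim(1))
  show "P q n d = 0" if "1 \<le> q" "n < d n"
    unfolding P_def D_def[symmetric] by (rule lim(2)) (assumption | fact that)+
qed

section \<open>Convergence in law from path probabilities\<close>

lemma tendsto_fun_iff:
  fixes x :: "'b \<Rightarrow> 'i \<Rightarrow> 'a::topological_space"
  shows "(x \<longlongrightarrow> l) F \<longleftrightarrow> (\<forall>i. ((\<lambda>j. x j i) \<longlongrightarrow> l i) F)"
  using limitin_componentwise[of "\<lambda>_. euclidean" UNIV x l F]
  by (simp add: euclidean_product_topology)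

lemma compact_box_fun:
  fixes a b :: "'i \<Rightarrow> real"
  shows "compact {x. \<forall>i. x i \<in> {a i..b i}}"
proof -
  have "compactin (product_topology (\<lambda>_. euclidean) UNIV) (PiE UNIV (\<lambda>i. {a i..b i}))"
    unfolding compactin_PiE by simp
  moreover have "PiE UNIV (\<lambda>i. {a i..b i}) = {x. \<forall>i. x i \<in> {a i..b i}}"
    by (auto simp: PiE_def Pi_def)
  ultimately show ?thesis by (simp add: euclidean_product_topology)
qed

text \<open>If this failed, a sequence of counterexamples in the compact box would have a convergent
  subsequence; the truncated points converge to the same limit, which contradicts continuity there.\<close>

lemma continuous_uniformly_truncatable:
  fixes f :: "(nat \<Rightarrow> real) \<Rightarrow> real" and b :: "nat \<Rightarrow> real"
  assumes f: "continuous_on UNIV f" and e: "e > 0"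
  obtains m where "\<And>x. (\<And>n. x n \<in> {0..b n}) \<Longrightarrow>
    \<bar>f x - f (\<lambda>n. if n \<le> m then x n else 0)\<bar> \<le> e"
proof -
  define tr where "tr m x = (\<lambda>n. if n \<le> m then x n else (0::real))" for m :: nat and x
  have "\<exists>m. \<forall>x. (\<forall>n. x n \<in> {0..b n}) \<longrightarrow> \<bar>f x - f (tr m x)\<bar> \<le> e"
  proof (rule ccontr)
    assume "\<not> ?thesis"
    then have "\<forall>m. \<exists>x. (\<forall>n. x n \<in> {0..b n}) \<and> \<not> \<bar>f x - f (tr m x)\<bar> \<le> e"
      by blast
    then obtain x where "\<forall>m. (\<forall>n. x m n \<in> {0..b n}) \<and> \<not> \<bar>f (x m) - f (tr m (x m))\<bar> \<le> e"
      unfolding choice_iff by (elim exE)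
    then have x: "x m n \<in> {0..b n}" "\<bar>f (x m) - f (tr m (x m))\<bar> > e" for m n
      by (simp_all only: not_le)
    have "seq_compact {x. \<forall>i. x i \<in> {0..b i}}"
      using compact_box_fun[of "\<lambda>_. 0" b] compact_imp_seq_compact by blast
    moreover have "\<forall>m. x m \<in> {x. \<forall>i. x i \<in> {0..b i}}" using x(1) by simp
    ultimately obtain l s where s: "strict_mono s" "(x \<circ> s) \<longlonglongrightarrow> l"
      by (rule seq_compactE)
    have cf: "isCont f y" for y using f continuous_on_eq_continuous_at by blast
    have "(\<lambda>j. tr (s j) (x (s j))) \<longlonglongrightarrow> l"
      unfolding tendsto_fun_iff
    proof
      fix n
      have "(\<lambda>j. x (s j) n) \<longlonglongrightarrow> l n" using s(2) unfolding tendsto_fun_iff o_def by blast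
      moreover have "eventually (\<lambda>j. n \<le> s j) sequentially"
        using filterlim_subseq[OF s(1)] unfolding filterlim_at_top by blast
      then have "eventually (\<lambda>j. x (s j) n = tr (s j) (x (s j)) n) sequentially"
        by eventually_elim (simp add: tr_def)
      ultimately show "(\<lambda>j. tr (s j) (x (s j)) n) \<longlonglongrightarrow> l n"
        by (rule Lim_transform_eventually)
    qed
    then have "(\<lambda>j. f (tr (s j) (x (s j)))) \<longlonglongrightarrow> f l" by (rule isCont_tendsto_compose[OF cf])
    moreover have "(\<lambda>j. f (x (s j))) \<longlonglongrightarrow> f l"
      using isCont_tendsto_compose[OF cf s(2)] by (simp add: o_def)
    ultimately have "(\<lambda>j. \<bar>f (x (s j)) - f (tr (s j) (x (s j)))\<bar>) \<longlonglongrightarrow> \<bar>f l - f l\<bar>"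
      by (intro tendsto_intros)
    then have "eventually (\<lambda>j. \<bar>f (x (s j)) - f (tr (s j) (x (s j)))\<bar> < e) sequentially"
      using e by (auto intro: order_tendstoD)
    then show False using x(2) unfolding eventually_sequentially by (meson less_asym order_refl)
  qed
  then show ?thesis using that unfolding tr_def by blast
qed

text \<open>The sum is the expectation of the truncated functional: almost surely the coordinates up to \<open>m\<close> take one
  of finitely many values.\<close>

lemma (in prob_space) expectation_path_approx:
  fixes D :: "nat \<Rightarrow> 'a \<Rightarrow> nat" and f :: "(nat \<Rightarrow> real) \<Rightarrow> real"
  assumes D [measurable]: "\<And>n. D n \<in> M \<rightarrow>\<^sub>M count_space UNIV"
    and bound: "AE w in M. \<forall>n. D n w \<le> n"
    and f [measurable]: "f \<in> borel_measurable borel" and B: "\<And>x. \<bar>f x\<bar> \<le> B"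
    and tr: "\<And>x. (\<And>n. x n \<in> {0..real n}) \<Longrightarrow>
      \<bar>f x - f (\<lambda>n. if n \<le> m then x n else 0)\<bar> \<le> e"
  shows "\<bar>(\<integral>w. f (\<lambda>n. real (D n w)) \<partial>M) -
    (\<Sum>d\<in>Pi\<^sub>E {..m} (\<lambda>i. {..i}). f (\<lambda>n. if n \<le> m then real (d n) else 0) * \<P>(w in M. \<forall>i\<le>m. D i w = d i))\<bar> \<le> e"
proof -
  let ?F = "Pi\<^sub>E {..m} (\<lambda>i. {..i})"
  define g where "g d = f (\<lambda>n. if n \<le> m then real (d n) else 0)" for d :: "nat \<Rightarrow> nat"
  define A where "A d = {w \<in> space M. \<forall>i\<le>m. D i w = d i}" for d
  have [measurable]: "A d \<in> sets M" for d unfolding A_def by measurable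
  have finF: "finite ?F" by (intro finite_PiE) auto
  have [measurable]: "(\<lambda>w n. real (D n w)) \<in> borel_measurable M"
    by (rule measurable_coordinatewise_then_product) measurable
  have int: "integrable M (\<lambda>w. f (\<lambda>n. real (D n w)))"
    by (rule integrable_const_bound[of _ B]) (use B in auto)
  have int2: "integrable M (\<lambda>w. g d * indicator (A d) w)" for d
    by (intro integrable_mult_right integrable_real_indicator) (auto simp: emeasure_eq_measure)
  have "(\<integral>w. f (\<lambda>n. real (D n w)) \<partial>M) - (\<Sum>d\<in>?F. g d * prob (A d)) =
    (\<integral>w. f (\<lambda>n. real (D n w)) - (\<Sum>d\<in>?F. g d * indicator (A d) w) \<partial>M)"
    using int int2 by (simp add: Bochner_Integration.integral_diff Bochner_Integration.integral_sum)
  also have "\<bar>\<dots>\<bar> \<le> (\<integral>w. \<bar>f (\<lambda>n. real (D n w)) - (\<Sum>d\<in>?F. g d * indicator (A d) w)\<bar> \<partial>M)"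
    by (rule integral_abs_bound)
  also have "\<dots> \<le> (\<integral>w. e \<partial>M)"
  proof (rule integral_mono_AE)
    show "integrable M (\<lambda>w. \<bar>f (\<lambda>n. real (D n w)) - (\<Sum>d\<in>?F. g d * indicator (A d) w)\<bar>)"
      using int int2 by (intro integrable_abs Bochner_Integration.integrable_diff Bochner_Integration.integrable_sum) auto
    show "AE w in M. \<bar>f (\<lambda>n. real (D n w)) - (\<Sum>d\<in>?F. g d * indicator (A d) w)\<bar> \<le> e"
      using bound AE_space
    proof eventually_elim
      case (elim w)
      let ?d = "restrict (\<lambda>i. D i w) {..m}"
      have d: "?d \<in> ?F" using elim by auto
      have "indicator (A d) w = (if d = ?d then 1 else (0::real))" if "d \<in> ?F" for d
        using that elim(2) unfolding A_def
        by (auto simp: indicator_def PiE_def extensional_def fun_eq_iff)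
      then have "(\<Sum>d\<in>?F. g d * indicator (A d) w) = (\<Sum>d\<in>?F. if d = ?d then g d else 0)"
        by (intro sum.cong) auto
      also have "\<dots> = g ?d" using d finF by simp
      also have "\<dots> = f (\<lambda>n. if n \<le> m then real (D n w) else 0)"
        unfolding g_def by (intro arg_cong[where f = f]) auto
      finally show ?case using tr[of "\<lambda>n. real (D n w)"] elim(1) by simp
    qed
  qed simp
  also have "\<dots> = e" by (simp add: prob_space)
  finally show ?thesis unfolding g_def A_def .
qed

text \<open>There are only countably many finite paths.\<close>

lemma (in prob_space) AE_bounded_if_path_null:
  fixes D :: "nat \<Rightarrow> 'a \<Rightarrow> nat" and b :: "nat \<Rightarrow> nat"
  assumes D [measurable]: "\<And>n. D n \<in> M \<rightarrow>\<^sub>M count_space UNIV"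
    and null: "\<And>(n::nat) (d::nat \<Rightarrow> nat). b n < d n \<Longrightarrow> \<P>(w in M. \<forall>i\<le>n. D i w = d i) = 0"
  shows "AE w in M. \<forall>n::nat. D n w \<le> b n"
  unfolding AE_all_countable
proof
  fix n :: nat
  let ?F = "{..n} \<rightarrow>\<^sub>E (UNIV :: nat set)"
  have "countable {d \<in> ?F. b n < d n}"
    by (rule countable_subset[OF _ countable_PiE[of "{..n}" "\<lambda>_. UNIV"]]) auto
  then have "AE w in M. \<forall>d\<in>{d \<in> ?F. b n < d n}. \<not> (\<forall>i\<le>n. D i w = d i)"
    unfolding AE_ball_countable[OF \<open>countable _\<close>] using null by (auto simp: prob_Collect_eq_0)
  then show "AE w in M. D n w \<le> b n"
  proof eventually_elim
    case (elim w)
    then show ?case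
      using elim[rule_format, of "restrict (\<lambda>i. D i w) {..n}"] by (auto simp: not_less[symmetric])
  qed
qed

text \<open>Exact nullity of the paths that leave the box is required for each \<open>q\<close>, since the truncation error has to be
  controlled on whole trajectories, uniformly in \<open>q\<close>.\<close>

lemma converges_in_law_if_paths:
  fixes D :: "nat \<Rightarrow> nat \<Rightarrow> 'm \<Rightarrow> nat" and D' :: "nat \<Rightarrow> 'n \<Rightarrow> nat"
  assumes M: "\<And>q. 1 \<le> q \<Longrightarrow> prob_space (M q)"
    and D: "\<And>q n. 1 \<le> q \<Longrightarrow> D q n \<in> M q \<rightarrow>\<^sub>M count_space UNIV"
    and null: "\<And>q n d. 1 \<le> q \<Longrightarrow> n < d n \<Longrightarrow> \<P>(w in M q. \<forall>i\<le>n. D q i w = d i) = 0"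
    and N: "prob_space N"
    and D' [measurable]: "\<And>n. D' n \<in> N \<rightarrow>\<^sub>M count_space UNIV"
    and Y [measurable]: "\<And>n. (\<lambda>w. Y w n) \<in> borel_measurable N"
    and Y_eq: "AE w in N. \<forall>n. Y w n = real (D' n w)"
    and lim: "\<And>n d. (\<lambda>q. \<P>(w in M q. \<forall>i\<le>n. D q i w = d i))
      \<longlonglongrightarrow> \<P>(w in N. \<forall>i\<le>n. D' i w = d i)"
  shows "converges_in_law M (\<lambda>q w n. real (D q n w)) N Y"
  unfolding converges_in_law_def
proof (intro conjI allI impI)
  show "\<forall>\<^sub>F q in sequentially. (\<lambda>w n. real (D q n w)) \<in> borel_measurable (M q)"
    using eventually_ge_at_top[of 1]
  proof eventually_elim
    case (elim q)
    note [measurable] = D[OF elim]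
    show ?case by (rule measurable_coordinatewise_then_product) measurable
  qed
  show Ym [measurable]: "Y \<in> borel_measurable N"
    by (rule measurable_coordinatewise_then_product) measurable
  fix f :: "(nat \<Rightarrow> real) \<Rightarrow> real"
  assume f: "continuous_on UNIV f \<and> bounded (range f)"
  then have [measurable]: "f \<in> borel_measurable borel"
    by (intro borel_measurable_continuous_onI) auto
  obtain B where B: "\<And>x. \<bar>f x\<bar> \<le> B" using f unfolding bounded_iff by auto
  interpret N: prob_space N by (rule N)
  have null': "\<P>(w in N. \<forall>i\<le>n. D' i w = d i) = 0" if "n < d n" for n d
  proof -
    have "eventually (\<lambda>q. \<P>(w in M q. \<forall>i\<le>n. D q i w = d i) = 0) sequentially"
      using eventually_ge_at_top[of 1] by eventually_elim (use null that in auto)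
    then have "(\<lambda>q. \<P>(w in M q. \<forall>i\<le>n. D q i w = d i)) \<longlonglongrightarrow> 0"
      by (rule tendsto_eventually)
    then show ?thesis using lim LIMSEQ_unique by blast
  qed
  have [measurable]: "(\<lambda>w n. real (D' n w)) \<in> borel_measurable N"
    by (rule measurable_coordinatewise_then_product) measurable
  have Yint: "(\<integral>w. f (Y w) \<partial>N) = (\<integral>w. f (\<lambda>n. real (D' n w)) \<partial>N)"
  proof (rule integral_cong_AE)
    show "AE w in N. f (Y w) = f (\<lambda>n. real (D' n w))"
      using Y_eq by eventually_elim (auto intro!: arg_cong[where f = f])
  qed measurable
  show "(\<lambda>q. \<integral>w. f (\<lambda>n. real (D q n w)) \<partial>M q) \<longlonglongrightarrow> (\<integral>w. f (Y w) \<partial>N)"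
    unfolding Yint
  proof (rule LIMSEQ_I)
    fix e :: real assume "0 < e"
    then have e: "e / 3 > 0" by simp
    obtain m where m: "\<And>x. (\<And>n. x n \<in> {0..real n}) \<Longrightarrow>
        \<bar>f x - f (\<lambda>n. if n \<le> m then x n else 0)\<bar> \<le> e / 3"
      using continuous_uniformly_truncatable[OF conjunct1[OF f] e] by blast
    define T where "T P = (\<Sum>d\<in>Pi\<^sub>E {..m} (\<lambda>i. {..i}). f (\<lambda>n. if n \<le> m then real (d n) else 0) * P d)"
      for P :: "(nat \<Rightarrow> nat) \<Rightarrow> real"
    define a where "a q = T (\<lambda>d. \<P>(w in M q. \<forall>i\<le>m. D q i w = d i))" for q
    define b where "b = T (\<lambda>d. \<P>(w in N. \<forall>i\<le>m. D' i w = d i))"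
    have 1: "\<bar>(\<integral>w. f (\<lambda>n. real (D q n w)) \<partial>M q) - a q\<bar> \<le> e / 3" if "1 \<le> q" for q
      unfolding a_def T_def
      by (intro prob_space.expectation_path_approx[OF M] prob_space.AE_bounded_if_path_null[OF M])
        (use that D null B m in auto)
    have 2: "\<bar>(\<integral>w. f (\<lambda>n. real (D' n w)) \<partial>N) - b\<bar> \<le> e / 3"
      unfolding b_def T_def
      by (intro N.expectation_path_approx N.AE_bounded_if_path_null) (use null' B m in auto)
    have "a \<longlonglongrightarrow> b" unfolding a_def b_def T_def by (intro tendsto_intros lim)
    then obtain n0 where n0: "\<And>q. n0 \<le> q \<Longrightarrow> \<bar>a q - b\<bar> < e / 3"
      using LIMSEQ_D[OF _ e] by force
    show "\<exists>n0. \<forall>q\<ge>n0. norm ((\<integral>w. f (\<lambda>n. real (D q n w)) \<partial>M q) - (\<integral>w. f (\<lambda>n. real (D' n w)) \<partial>N)) < e"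
    proof (intro exI allI impI)
      fix q assume "max 1 n0 \<le> q"
      then show "norm ((\<integral>w. f (\<lambda>n. real (D q n w)) \<partial>M q) - (\<integral>w. f (\<lambda>n. real (D' n w)) \<partial>N)) < e"
        using 1[of q] 2 n0[of q] unfolding real_norm_def by linarith
    qed
  qed
qed

section \<open>Convergence of the distance processes\<close>

theorem theorem6p5:
  fixes V :: "nat \<Rightarrow> 'v set"
    and E :: "nat \<Rightarrow> 'v \<Rightarrow> 'v \<Rightarrow> bool"
    and r :: "nat \<Rightarrow> 'v"
    and \<omega> :: "nat \<Rightarrow> nat \<Rightarrow> 'v"
    and MS :: "nat \<Rightarrow> 'a measure" and S :: "nat \<Rightarrow> nat \<Rightarrow> 'a \<Rightarrow> 'v"
    and MW :: "nat \<Rightarrow> 'b measure" and W0 :: "nat \<Rightarrow> nat \<Rightarrow> 'b \<Rightarrow> 'v"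
    and N :: "'c measure" and \<Sigma> :: "nat \<Rightarrow> 'c \<Rightarrow> int"
  assumes tree: "\<And>q. q \<ge> 1 \<Longrightarrow> homogeneous_tree q (V q) (E q)"
    and origin: "\<And>q. q \<ge> 1 \<Longrightarrow> r q \<in> V q"
    and ray: "\<And>q. q \<ge> 1 \<Longrightarrow> geodesic_ray (V q) (E q) (r q) (\<omega> q)"
    and S: "\<And>q. q \<ge> 1 \<Longrightarrow>
      markov_chain (MS q) (V q) (r q)
        (ground_trans q (E q) (phi_ray q (E q) (r q) (\<omega> q))) (S q)"
    and W0: "\<And>q. q \<ge> 1 \<Longrightarrow>
      markov_chain (MW q) (V q) (r q)
        (ground_trans q (E q) (phi_zero q (E q) (r q))) (W0 q)"
    and \<Sigma>: "markov_chain N UNIV 0 int_srw_trans \<Sigma>"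
  shows "converges_in_law
           MS (\<lambda>q w n. real (graph_dist (E q) (r q) (S q n w)))
           N (\<lambda>w n. real_of_int (2 * (MAX k\<in>{0..n}. \<Sigma> k w) - \<Sigma> n w))
       \<and> converges_in_law
           MW (\<lambda>q w n. real (graph_dist (E q) (r q) (W0 q n w)))
           N (\<lambda>w n. real_of_int (2 * (MAX k\<in>{0..n}. \<Sigma> k w) - \<Sigma> n w))"
proof -
  define D' where "D' n w = nat (2 * (MAX k\<in>{0..n}. \<Sigma> k w) - \<Sigma> n w)" for n w
  have N: "prob_space N" using \<Sigma> unfolding markov_chain_def by blast
  have [measurable]: "\<Sigma> n \<in> N \<rightarrow>\<^sub>M count_space UNIV" for n
    using \<Sigma> unfolding markov_chain_def by blast
  note [measurable] = measurable_running_MAX[of \<Sigma> N]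
  have D'_meas: "D' n \<in> N \<rightarrow>\<^sub>M count_space UNIV" for n
    unfolding D'_def[abs_def] by measurable
  have Y_meas: "(\<lambda>w. real_of_int (2 * (MAX k\<in>{0..n}. \<Sigma> k w) - \<Sigma> n w)) \<in> borel_measurable N" for n
    by measurable
  have "AE w in N. \<Sigma> 0 w = 0" using \<Sigma> unfolding markov_chain_def by blast
  then have Y_eq: "AE w in N. \<forall>n. real_of_int (2 * (MAX k\<in>{0..n}. \<Sigma> k w) - \<Sigma> n w) = real (D' n w)"
  proof eventually_elim
    case (elim w)
    have "0 \<le> (MAX k\<in>{0..n}. \<Sigma> k w)" "\<Sigma> n w \<le> (MAX k\<in>{0..n}. \<Sigma> k w)" for n
      using Max_ge[of "(\<lambda>k. \<Sigma> k w) ` {0..n}" "\<Sigma> 0 w"] elim by auto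
    then show ?case unfolding D'_def by (smt (verit) of_nat_nat of_int_of_nat_eq)
  qed
  have path: "\<P>(w in N. \<forall>i\<le>n. D' i w = d i) = bessel_path_weight n d" for n d
    unfolding D'_def by (rule pitman_paths[OF \<Sigma>])
  have MS: "prob_space (MS q)" and MW: "prob_space (MW q)" if "1 \<le> q" for q
    using S[OF that] W0[OF that] unfolding markov_chain_def by blast+
  have S_lim: "(\<lambda>q. \<P>(w in MS q. \<forall>i\<le>n. graph_dist (E q) (r q) (S q i w) = d i))
      \<longlonglongrightarrow> \<P>(w in N. \<forall>i\<le>n. D' i w = d i)"
    and W0_lim: "(\<lambda>q. \<P>(w in MW q. \<forall>i\<le>n. graph_dist (E q) (r q) (W0 q i w) = d i))
      \<longlonglongrightarrow> \<P>(w in N. \<forall>i\<le>n. D' i w = d i)" for n d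
    unfolding path
    by (rule phi_ray_chain_paths(1)[OF tree ray S] phi_zero_chain_paths(1)[OF tree origin W0]; assumption)+
  have S_null: "\<P>(w in MS q. \<forall>i\<le>n. graph_dist (E q) (r q) (S q i w) = d i) = 0"
    and W0_null: "\<P>(w in MW q. \<forall>i\<le>n. graph_dist (E q) (r q) (W0 q i w) = d i) = 0"
    if "1 \<le> q" "n < d n" for q n d
    by (rule phi_ray_chain_paths(2)[OF tree ray S] phi_zero_chain_paths(2)[OF tree origin W0];
        (assumption | fact that))+
  show ?thesis
    using converges_in_law_if_paths[OF MS measurable_markov_chain_fun[OF S] S_null N D'_meas Y_meas Y_eq S_lim]
      converges_in_law_if_paths[OF MW measurable_markov_chain_fun[OF W0] W0_null N D'_meas Y_meas Y_eq W0_lim]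
    by blast
qed

end
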